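(* Let $L$ be a (full-rank) sublattice of $\mathbb{H}$. The Dirichlet series $\zeta_L^{\mathrm{SL}}(s)$ has abscissa of convergence $\Re(s)=2$. It can be meromorphically continued to the half-plane $\Re(s)>1$ and has a simple pole at $s=2$.
   Context: $\mathbb{H}=\mathbb{Z}e_1+\mathbb{Z}e_2$ is the free rank-2 $\mathbb{Z}$-module with quadratic form $Q$ and symmetric bilinear form $B(x,y)=\frac12(Q(x+y)-Q(x)-Q(y))$ given by $Q(e_1)=Q(e_2)=0$, $B(e_1,e_2)=\frac12$ (so $Q(xe_1+ye_2)=xy$). A sublattice means a subgroup of rank 2 (finite index), with the restricted form. Let $V=\mathbb{Q}L$. $O(V)=\{\sigma\in\mathrm{GL}(V): B(\sigma x,\sigma y)=B(x,y)\ \forall x,y\in V\}$ and $O^+(V)=O(V)\cap \mathrm{SL}(V)$. Two lattices $K_1,K_2$ in $V$ are properly isometric if $\sigma(K_1)=K_2$ for some $\sigma\in O^+(V)$. For $m\in\mathbb{N}$, $a_m^+(L)$ is the number of proper isometry classes among the sublattices $K\subseteq L$ with $[L:K]=m$, and $\zeta_L^{\mathrm{SL}}(s)=\sum_{m\ge1}a_m^+(L)m^{-s}$. *)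

theory Defs
  imports "HOL-Complex_Analysis.Complex_Analysis" "HOL-Algebra.Coset"
begin

text \<open>
  The ambient quadratic space is \<open>V = \<rat>\<^sup>2\<close>, written \<open>rat ^ 2\<close>. A sublattice \<open>L\<close> of finite index
  in the hyperbolic plane satisfies \<open>\<rat>L = V\<close>, so the orthogonal groups of \<open>\<rat>L\<close> are those of \<open>V\<close>,
  and \<open>GL(V)\<close> consists of the invertible \<open>2 \<times> 2\<close> rational matrices.
\<close>

definition quad_form :: "rat ^ 2 \<Rightarrow> rat" where
  "quad_form v = v $ 1 * v $ 2"

definition bilin_form :: "rat ^ 2 \<Rightarrow> rat ^ 2 \<Rightarrow> rat" where
  "bilin_form x y = (quad_form (x + y) - quad_form x - quad_form y) / 2"

lemma quad_form_basis:
  "quad_form (axis 1 1) = 0" "quad_form (axis 2 1) = 0"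
  "bilin_form (axis 1 1) (axis 2 1) = 1 / 2"
  by (simp_all add: quad_form_def bilin_form_def axis_def)

definition hyperbolic_plane :: "(rat ^ 2) set" where
  "hyperbolic_plane = {of_int a *s axis 1 1 + of_int b *s axis 2 1 | a b. True}"

definition additive_group :: "(rat ^ 2) set \<Rightarrow> (rat ^ 2) monoid" where
  "additive_group A = \<lparr>carrier = A, mult = (+), one = 0\<rparr>"

text \<open>
  For a subgroup of a free abelian group of rank 2, having rank 2 means having finite index.
\<close>

definition sublattice :: "(rat ^ 2) set \<Rightarrow> (rat ^ 2) set \<Rightarrow> bool" where
  "sublattice K L \<longleftrightarrow>
     subgroup K (additive_group L) \<and> finite (rcosets\<^bsub>additive_group L\<^esub> K)"

definition lattice_index :: "(rat ^ 2) set \<Rightarrow> (rat ^ 2) set \<Rightarrow> nat" where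
  "lattice_index L K = card (rcosets\<^bsub>additive_group L\<^esub> K)"

definition orthogonal_group :: "(rat ^ 2 ^ 2) set" where
  "orthogonal_group =
     {A. invertible A \<and> (\<forall>x y. bilin_form (A *v x) (A *v y) = bilin_form x y)}"

definition special_orthogonal_group :: "(rat ^ 2 ^ 2) set" where
  "special_orthogonal_group = orthogonal_group \<inter> {A. det A = 1}"

definition properly_isometric :: "((rat ^ 2) set \<times> (rat ^ 2) set) set" where
  "properly_isometric = {(K1, K2). \<exists>A \<in> special_orthogonal_group. (*v) A ` K1 = K2}"

definition num_proper_classes :: "(rat ^ 2) set \<Rightarrow> nat \<Rightarrow> nat" where
  "num_proper_classes L m =
     card ({K. sublattice K L \<and> lattice_index L K = m} // properly_isometric)"

text \<open>
  Dirichlet series are indexed by \<open>m \<ge> 1\<close>; the coefficient at \<open>0\<close> is ignored.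
\<close>

definition dirichlet_term :: "(nat \<Rightarrow> complex) \<Rightarrow> complex \<Rightarrow> nat \<Rightarrow> complex" where
  "dirichlet_term a s n = a (Suc n) * of_nat (Suc n) powr (- s)"

definition dirichlet_series :: "(nat \<Rightarrow> complex) \<Rightarrow> complex \<Rightarrow> complex" where
  "dirichlet_series a s = (\<Sum>n. dirichlet_term a s n)"

definition abscissa_of_convergence :: "(nat \<Rightarrow> complex) \<Rightarrow> ereal" where
  "abscissa_of_convergence a = (INF s \<in> {s. summable (dirichlet_term a s)}. ereal (Re s))"

definition zeta_SL_coeff :: "(rat ^ 2) set \<Rightarrow> nat \<Rightarrow> complex" where
  "zeta_SL_coeff L m = of_nat (num_proper_classes L m)"

definition zeta_SL :: "(rat ^ 2) set \<Rightarrow> complex \<Rightarrow> complex" where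
  "zeta_SL L = dirichlet_series (zeta_SL_coeff L)"

end

theory Submission
  imports Defs "HOL-Number_Theory.Cong" "HOL-Computational_Algebra.Squarefree"
begin

text \<open>
  Write \<open>a\<^sub>m\<close> for the number of proper isometry classes of sublattices of index \<open>m\<close>. The idea is to
  turn \<open>a\<^sub>m\<close> into a count of residue classes, and that count into a Dirichlet convolution in which
  only one factor grows.

  A matrix of determinant \<open>1\<close> preserving \<open>Q(x, y) = x y\<close> must be \<open>diag(t, 1/t)\<close>, because the
  images of the two basis vectors are isotropic. Such a stretching can be used to make the
  projection of a lattice to the second axis equal to \<open>\<int>\<close>; so every sublattice is properly isometric to
  one spanned by \<open>(A, 0)\<close> and \<open>(x, 1)\<close>, where \<open>A\<close> is its covolume, and \<open>x\<close> modulo \<open>A\<close> is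
  a complete invariant of its class (\<open>normal_lattice_isometric_iff\<close>). Bringing \<open>L\<close> into this form, with
  parameters \<open>N\<close> and \<open>\<beta>\<close>, and using Hermite normal forms for the sublattices of \<open>L\<close>, one finds
  (\<open>num_proper_classes_eq\<close>) that \<open>a\<^sub>m\<close> is the number of \<open>x\<close> modulo \<open>m N\<close> for which some \<open>k\<close>
  dividing \<open>m\<close> satisfies \<open>x \<equiv> \<beta> k\<^sup>2\<close> modulo \<open>k N\<close>. Taking \<open>k = 1\<close> shows \<open>m \<le> a\<^sub>m \<le> N m\<close>.

  Put \<open>n = m N\<close> and sort the \<open>x\<close> by \<open>D = gcd(x, n)\<close>. The condition then depends only on \<open>D\<close> and on
  \<open>n / D\<close> and \<open>x / D\<close> modulo \<open>N\<close>. Removing the coprimality of \<open>n / D\<close> and \<open>x / D\<close> by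
  Moebius inversion gives \<open>a\<^sub>m\<close> as the sum of \<open>w(D, e, f) f\<close> over all \<open>D e f = m N\<close>, with weights
  \<open>\<bar>w\<bar> \<le> 1\<close> that are periodic in \<open>f\<close> modulo \<open>N\<close> (\<open>sum_convolution_weight\<close>). Consequently
  \<open>N\<^sup>-\<^sup>s \<zeta>\<^sub>L(s)\<close> is a finite sum, over \<open>j\<close> modulo \<open>N\<close>, of products of two factors. One is a series over
  \<open>(D, e)\<close>, absolutely convergent for \<open>Re s > 1\<close>. The other is the sum of \<open>f\<^sup>1\<^sup>-\<^sup>s\<close> over an arithmetic
  progression, which becomes holomorphic on \<open>Re s > 1\<close> when multiplied by \<open>s - 2\<close>
  (\<open>has_sum_dirichlet_convolution\<close>, \<open>holomorphic_dirichlet_convolution\<close>).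

  Hence \<open>\<zeta>\<^sub>L(s) = W(s) / (s - 2)\<close> with \<open>W\<close> holomorphic on \<open>Re s > 1\<close>. That \<open>W(2) \<noteq> 0\<close>
  follows from positivity: if \<open>W(2)\<close> vanished, \<open>\<zeta>\<^sub>L\<close> would stay bounded as \<open>s\<close> decreases to \<open>2\<close>, but the bound
  \<open>m \<le> a\<^sub>m\<close> forces the series at \<open>s = 2\<close> to dominate the harmonic series. The same divergence
  identifies the abscissa of convergence (\<open>simple_pole_of_linear_growth\<close>).
\<close>

\<comment> \<open>Keep the dollar sign for vector components only.\<close>
no_notation fps_nth (infixl "$" 75)

section \<open>Sublattices of a lattice in the plane\<close>

definition int_span :: "rat ^ 2 \<Rightarrow> rat ^ 2 \<Rightarrow> (rat ^ 2) set" where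
  "int_span v w = {of_int a *s v + of_int b *s w | a b. True}"

definition int_independent :: "rat ^ 2 \<Rightarrow> rat ^ 2 \<Rightarrow> bool" where
  "int_independent v w \<longleftrightarrow>
     (\<forall>a b. of_int a *s v + of_int b *s w = 0 \<longrightarrow> a = 0 \<and> b = 0)"

text \<open>Additive subgroups as plain subsets of the vector space: all groups below share its
  operations, so their carriers determine them.\<close>

definition add_closed :: "(rat ^ 2) set \<Rightarrow> bool" where
  "add_closed K \<longleftrightarrow> 0 \<in> K \<and> (\<forall>x\<in>K. \<forall>y\<in>K. x + y \<in> K) \<and> (\<forall>x\<in>K. - x \<in> K)"

lemma inv_additive_group:
  assumes "x \<in> L" "- x \<in> L"
  shows "inv\<^bsub>additive_group L\<^esub> x = - x"
  unfolding m_inv_def additive_group_def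
  using assms by (auto intro!: the_equality simp: add_eq_0_iff2 add.commute)

lemma subgroup_additive_group_iff:
  assumes "add_closed L"
  shows "subgroup K (additive_group L) \<longleftrightarrow> K \<subseteq> L \<and> add_closed K"
proof -
  have "inv\<^bsub>additive_group L\<^esub> x = - x" if "x \<in> L" for x
    using inv_additive_group that assms by (auto simp: add_closed_def)
  then show ?thesis
    unfolding subgroup_def add_closed_def by (auto simp: additive_group_def subset_iff)
qed

lemma int_combination_mem:
  assumes "add_closed K" "x \<in> K"
  shows "of_int n *s x \<in> K"
proof -
  have nat: "of_nat m *s x \<in> K" for m
  proof (induction m)
    case 0
    then show ?case using assms by (simp add: add_closed_def)
  next
    case (Suc m)
    have "of_nat (Suc m) *s x = of_nat m *s x + x" by (simp add: vec_eq_iff algebra_simps)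
    then show ?case using Suc assms unfolding add_closed_def by metis
  qed
  show ?thesis
  proof (cases n)
    case (nonneg m)
    then show ?thesis using nat[of m] by simp
  next
    case (neg m)
    have "of_int n *s x = - (of_nat (Suc m) *s x)" unfolding neg of_int_minus of_int_of_nat_eq
      by (simp add: vec_eq_iff)
    then show ?thesis using nat[of "Suc m"] assms(1) unfolding add_closed_def by metis
  qed
qed

lemma int_span_mem: "of_int a *s v + of_int b *s w \<in> int_span v w"
  by (auto simp: int_span_def)

lemma add_closed_int_span: "add_closed (int_span v w)"
proof -
  have "of_int a *s v + of_int b *s w + (of_int c *s v + of_int d *s w)
      = of_int (a + c) *s v + of_int (b + d) *s w" for a b c d
    by (simp add: vec_eq_iff algebra_simps)
  moreover have "- (of_int a *s v + of_int b *s w)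
      = of_int (- a) *s v + of_int (- b) *s w" for a b
    by (simp add: vec_eq_iff algebra_simps)
  moreover have "0 = of_int 0 *s v + of_int 0 *s w" by (simp add: vec_eq_iff)
  ultimately show ?thesis unfolding add_closed_def
    by (smt (verit, ccfv_SIG) int_span_def int_span_mem mem_Collect_eq)
qed

lemma int_span_subset:
  assumes "add_closed K" "v \<in> K" "w \<in> K"
  shows "int_span v w \<subseteq> K"
  using assms int_combination_mem by (auto simp: int_span_def add_closed_def)

lemma int_span_coeff_unique:
  assumes "int_independent v w"
    and "of_int a *s v + of_int b *s w = of_int c *s v + of_int d *s w"
  shows "a = c \<and> b = d"
proof -
  have "of_int (a - c) *s v + of_int (b - d) *s w
      = (of_int a *s v + of_int b *s w) - (of_int c *s v + of_int d *s w)"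
    by (simp add: vec_eq_iff algebra_simps)
  then have "of_int (a - c) *s v + of_int (b - d) *s w = 0" using assms(2) by simp
  then show ?thesis using assms(1) unfolding int_independent_def by fastforce
qed

lemma coset_additive_group: "K #>\<^bsub>additive_group L\<^esub> x = (\<lambda>k. k + x) ` K"
  by (auto simp: r_coset_def additive_group_def)

lemma coset_eq_iff:
  assumes "add_closed K"
  shows "(\<lambda>k. k + x) ` K = (\<lambda>k. k + y) ` K \<longleftrightarrow> x - y \<in> K"
proof
  assume eq: "(\<lambda>k. k + x) ` K = (\<lambda>k. k + y) ` K"
  have "x \<in> (\<lambda>k. k + x) ` K" using assms by (auto simp: add_closed_def image_iff)
  then obtain k where "k \<in> K" "x = k + y" using eq by auto
  then show "x - y \<in> K" by simp
next
  assume d: "x - y \<in> K"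
  have sub: "(\<lambda>k. k + u) ` K \<subseteq> (\<lambda>k. k + v) ` K" if "u - v \<in> K" for u v
  proof
    fix z assume "z \<in> (\<lambda>k. k + u) ` K"
    then obtain k where "k \<in> K" "z = k + u" by auto
    then have "k + (u - v) \<in> K" "z = (k + (u - v)) + v"
      using assms that by (auto simp: add_closed_def)
    then show "z \<in> (\<lambda>k. k + v) ` K" by blast
  qed
  have "- (x - y) \<in> K" using d assms unfolding add_closed_def by blast
  then have "y - x \<in> K" by simp
  then show "(\<lambda>k. k + x) ` K = (\<lambda>k. k + y) ` K" using sub d by (meson subset_antisym)
qed

lemma rcosets_additive_group:
  "rcosets\<^bsub>additive_group L\<^esub> K = (\<lambda>x. (\<lambda>k. k + x) ` K) ` L"
  unfolding RCOSETS_def by (auto simp: coset_additive_group) (auto simp: additive_group_def)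

text \<open>Linear independence makes coordinates unique, so membership in a sublattice with triangular
  basis matrix becomes a statement about integers.\<close>

lemma int_span_triangular_mem:
  assumes ind: "int_independent v w"
  shows "of_int p *s v + of_int q *s w
      \<in> int_span (of_int a *s v) (of_int b *s v + of_int d *s w)
    \<longleftrightarrow> (\<exists>s t. p = s * a + t * b \<and> q = t * d)"
proof -
  have e: "of_int s *s (of_int a *s v) + of_int t *s (of_int b *s v + of_int d *s w)
      = of_int (s * a + t * b) *s v + of_int (t * d) *s w" for s t
    by (simp add: vec_eq_iff algebra_simps)
  show ?thesis unfolding int_span_def mem_Collect_eq e
    using int_span_coeff_unique[OF ind] by blast
qed

text \<open>Division with remainder, first by \<open>d\<close> in the second coordinate and then by \<open>a\<close> in the first,
  moves each vector into the box \<open>[0, a) \<times> [0, d)\<close> without leaving its coset, and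
  distinct points of the box are incongruent. Hence the index of a triangular sublattice is \<open>a d\<close>.\<close>

lemma triangular_cosets:
  fixes a b d :: int
  assumes ind: "int_independent v w" and "a > 0" "d > 0"
  defines "K \<equiv> int_span (of_int a *s v) (of_int b *s v + of_int d *s w)"
  shows "bij_betw (\<lambda>(i, j). (\<lambda>k. k + (of_int i *s v + of_int j *s w)) ` K)
           ({0..<a} \<times> {0..<d}) (rcosets\<^bsub>additive_group (int_span v w)\<^esub> K)"
proof -
  let ?P = "\<lambda>i j. of_int i *s v + of_int j *s w"
  let ?f = "\<lambda>(i, j). (\<lambda>k. k + ?P i j) ` K"
  have cl: "add_closed K" unfolding K_def by (rule add_closed_int_span)
  have diff: "?P i j - ?P i' j' = ?P (i - i') (j - j')" for i j i' j'
    by (simp add: vec_eq_iff algebra_simps)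
  have eq: "?f (i, j) = ?f (i', j') \<longleftrightarrow> (\<exists>s t. i - i' = s * a + t * b \<and> j - j' = t * d)"
    for i j i' j'
    unfolding case_prod_conv coset_eq_iff[OF cl] diff
    unfolding K_def int_span_triangular_mem[OF ind] ..
  have inj: "inj_on ?f ({0..<a} \<times> {0..<d})"
  proof (rule inj_onI, clarsimp simp only: mem_Sigma_iff atLeastLessThan_iff)
    fix i j i' j'
    assume h: "0 \<le> i" "i < a" "0 \<le> j" "j < d" "0 \<le> i'" "i' < a" "0 \<le> j'" "j' < d"
      and "(\<lambda>k. k + ?P i j) ` K = (\<lambda>k. k + ?P i' j') ` K"
    then obtain s t where st: "i - i' = s * a + t * b" "j - j' = t * d"
      using eq[of i j i' j'] by auto
    have "d dvd j - j'" using st by simp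
    then have "j = j'" using h zdvd_imp_le[of d "j - j'"] zdvd_imp_le[of d "j' - j"]
      by (metis atLeastLessThan_iff dvd_minus_mod mod_pos_pos_trivial mod_eq_dvd_iff)
    then have "t = 0" using st \<open>d > 0\<close> by simp
    then have "a dvd i - i'" using st by simp
    then have "i = i'" using h by (metis mod_pos_pos_trivial mod_eq_dvd_iff)
    then show "i = i' \<and> j = j'" using \<open>j = j'\<close> by simp
  qed
  have "?f ` ({0..<a} \<times> {0..<d}) = (\<lambda>x. (\<lambda>k. k + x) ` K) ` int_span v w"
  proof (intro equalityI subsetI)
    fix X assume "X \<in> ?f ` ({0..<a} \<times> {0..<d})"
    then show "X \<in> (\<lambda>x. (\<lambda>k. k + x) ` K) ` int_span v w" using int_span_mem by fastforce
  next
    fix X assume "X \<in> (\<lambda>x. (\<lambda>k. k + x) ` K) ` int_span v w"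
    then obtain p q where X: "X = ?f (p, q)" by (auto simp: int_span_def)
    define t where "t = q div d"
    define s where "s = (p - t * b) div a"
    define i where "i = (p - t * b) mod a"
    define j where "j = q mod d"
    have pi: "p - i = s * a + t * b"
      unfolding i_def s_def by (simp add: minus_mod_eq_div_mult[symmetric])
    have qj: "q - j = t * d"
      unfolding j_def t_def by (simp add: minus_mod_eq_div_mult)
    have "X = ?f (i, j)" unfolding X eq using pi qj by blast
    moreover have "(i, j) \<in> {0..<a} \<times> {0..<d}" using assms by (auto simp: i_def j_def)
    ultimately show "X \<in> ?f ` ({0..<a} \<times> {0..<d})" by blast
  qed
  then show ?thesis using inj by (simp add: bij_betw_def rcosets_additive_group)
qed

lemma triangular_sublattice:
  fixes a b d :: int
  assumes ind: "int_independent v w" and "a > 0" "d > 0"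
  defines "K \<equiv> int_span (of_int a *s v) (of_int b *s v + of_int d *s w)"
  shows "sublattice K (int_span v w)" and "lattice_index (int_span v w) K = nat (a * d)"
proof -
  note bij = triangular_cosets[OF assms(1-3), of b, folded K_def]
  have "K \<subseteq> int_span v w"
    unfolding K_def
    by (rule int_span_subset[OF add_closed_int_span])
      (use int_span_mem[of a v 0 w] int_span_mem in auto)
  then show "sublattice K (int_span v w)"
    unfolding sublattice_def subgroup_additive_group_iff[OF add_closed_int_span]
    using add_closed_int_span bij_betw_finite[OF bij] by (auto simp: K_def)
  show "lattice_index (int_span v w) K = nat (a * d)"
    unfolding lattice_index_def using bij_betw_same_card[OF bij] assms(2,3)
    by (simp add: card_cartesian_product nat_mult_distrib)
qed

text \<open>Pigeonhole: two of the multiples \<open>0, x, 2x, \<dots>\<close> lie in the same coset.\<close>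

lemma finite_index_multiple_mem:
  assumes "add_closed K" "add_closed L" and fin: "finite (rcosets\<^bsub>additive_group L\<^esub> K)" and x: "x \<in> L"
  shows "\<exists>n>0. of_int n *s x \<in> K"
proof -
  have "(\<lambda>i::nat. (\<lambda>k. k + of_int (int i) *s x) ` K) ` UNIV \<subseteq> (\<lambda>x. (\<lambda>k. k + x) ` K) ` L"
    using int_combination_mem[OF assms(2) x] by blast
  then have "finite (range (\<lambda>i::nat. (\<lambda>k. k + of_int (int i) *s x) ` K))"
    using fin unfolding rcosets_additive_group by (rule finite_subset)
  then have "\<not> inj (\<lambda>i::nat. (\<lambda>k. k + of_int (int i) *s x) ` K)"
    using finite_imageD infinite_UNIV_nat by blast
  then obtain i j :: nat where ij: "i < j"
    "(\<lambda>k. k + of_int (int j) *s x) ` K = (\<lambda>k. k + of_int (int i) *s x) ` K"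
    unfolding inj_def by (metis linorder_neqE_nat)
  then have "of_int (int j) *s x - of_int (int i) *s x \<in> K"
    using coset_eq_iff[OF assms(1)] by blast
  moreover have "of_int (int j) *s x - of_int (int i) *s x = of_int (int j - int i) *s x"
    by (simp add: vec_eq_iff algebra_simps)
  ultimately show ?thesis using ij(1) by (intro exI[of _ "int j - int i"]) auto
qed

text \<open>Hermite normal form. With \<open>a\<close> the least positive integer such that \<open>a v \<in> K\<close>, and \<open>d\<close> the least
  positive \<open>w\<close>-coordinate of an element of \<open>K\<close>, both exist because \<open>K\<close> has finite index;
  minimality forces the remainders of any element of \<open>K\<close> to vanish.\<close>

lemma sublattice_triangular:
  assumes "sublattice K (int_span v w)"
  obtains a b d :: int where "a > 0" "d > 0"
    "K = int_span (of_int a *s v) (of_int b *s v + of_int d *s w)"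
proof -
  let ?P = "\<lambda>i j. of_int i *s v + of_int j *s w"
  have K: "K \<subseteq> int_span v w" "add_closed K"
    and fin: "finite (rcosets\<^bsub>additive_group (int_span v w)\<^esub> K)"
    using assms unfolding sublattice_def subgroup_additive_group_iff[OF add_closed_int_span] by auto
  have mult: "\<exists>n>0. of_int n *s x \<in> K" if "x \<in> int_span v w" for x
    using finite_index_multiple_mem[OF K(2) add_closed_int_span fin that] .
  have lc: "of_int n *s x + of_int m *s y \<in> K" if "x \<in> K" "y \<in> K" for n m x y
    using int_combination_mem[OF K(2)] that K(2) unfolding add_closed_def by blast
  define A where "A = (\<lambda>n::nat. n > 0 \<and> of_int (int n) *s v \<in> K)"
  define D where "D = (\<lambda>n::nat. n > 0 \<and> (\<exists>b. ?P b (int n) \<in> K))"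
  have "\<exists>n. A n"
  proof -
    have "v = ?P 1 0" by (simp add: vec_eq_iff)
    then obtain n where "n > 0" "of_int n *s v \<in> K" using mult int_span_mem by metis
    then show ?thesis by (intro exI[of _ "nat n"]) (auto simp: A_def)
  qed
  define a where "a = (LEAST n. A n)"
  have Aa: "A a" unfolding a_def using \<open>\<exists>n. A n\<close> by (metis LeastI)
  have "\<exists>n. D n"
  proof -
    have "w = ?P 0 1" by (simp add: vec_eq_iff)
    then obtain n where n: "n > 0" "of_int n *s w \<in> K" using mult int_span_mem by metis
    have "?P 0 n = of_int n *s w" by (simp add: vec_eq_iff)
    then have "?P 0 n \<in> K" using n by metis
    then show ?thesis using n by (intro exI[of _ "nat n"]) (auto simp: D_def intro!: exI[of _ 0])
  qed
  define d where "d = (LEAST n. D n)"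
  have Dd: "D d" unfolding d_def using \<open>\<exists>n. D n\<close> by (metis LeastI)
  then obtain b where b: "?P b (int d) \<in> K" by (auto simp: D_def)
  have ad: "a > 0" "d > 0" "of_int (int a) *s v \<in> K" using Aa Dd by (auto simp: A_def D_def)
  have "K \<subseteq> int_span (of_int (int a) *s v) (?P b (int d))"
  proof
    fix x assume x: "x \<in> K"
    then obtain p q where pq: "x = ?P p q" using K(1) by (auto simp: int_span_def)
    define t where "t = q div int d"
    define p' where "p' = p - t * b"
    have "of_int 1 *s x + of_int (- t) *s ?P b (int d) = ?P p' (q - t * int d)"
      unfolding pq p'_def by (simp add: vec_eq_iff algebra_simps)
    moreover have "q - t * int d = q mod int d"
      unfolding t_def by (simp add: minus_div_mult_eq_mod)
    ultimately have mem: "?P p' (q mod int d) \<in> K" using lc[OF x b, of 1 "- t"] by metis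
    have q0: "q mod int d = 0"
    proof (rule ccontr)
      assume "q mod int d \<noteq> 0"
      then have "q mod int d > 0" using ad(2)
        by (metis of_nat_0_less_iff order_le_less pos_mod_sign)
      then have "D (nat (q mod int d))" using mem by (auto simp: D_def)
      then have "d \<le> nat (q mod int d)" unfolding d_def by (rule Least_le)
      then show False using ad(2) pos_mod_bound[of "int d" q] by linarith
    qed
    have pv: "of_int p' *s v \<in> K" using mem q0 by simp
    define s where "s = p' div int a"
    have "of_int 1 *s (of_int p' *s v) + of_int (- s) *s (of_int (int a) *s v)
        = of_int (p' - s * int a) *s v"
      by (simp add: vec_eq_iff algebra_simps)
    moreover have "p' - s * int a = p' mod int a"
      unfolding s_def by (simp add: minus_div_mult_eq_mod)
    ultimately have mem2: "of_int (p' mod int a) *s v \<in> K"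
      using lc[OF pv ad(3), of 1 "- s"] by metis
    have p0: "p' mod int a = 0"
    proof (rule ccontr)
      assume "p' mod int a \<noteq> 0"
      then have "p' mod int a > 0" using ad(1)
        by (metis of_nat_0_less_iff order_le_less pos_mod_sign)
      then have "A (nat (p' mod int a))" using mem2 by (auto simp: A_def)
      then have "a \<le> nat (p' mod int a)" unfolding a_def by (rule Least_le)
      then show False using ad(1) pos_mod_bound[of "int a" p'] by linarith
    qed
    have "p = s * int a + t * b" "q = t * int d"
      using p0 q0 unfolding p'_def s_def t_def by (auto simp: mod_eq_0_iff_dvd algebra_simps)
    then have "x = of_int s *s (of_int (int a) *s v) + of_int t *s ?P b (int d)"
      unfolding pq by (simp add: vec_eq_iff algebra_simps)
    then show "x \<in> int_span (of_int (int a) *s v) (?P b (int d))" using int_span_mem by metis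
  qed
  moreover have "int_span (of_int (int a) *s v) (?P b (int d)) \<subseteq> K"
    by (rule int_span_subset[OF K(2) ad(3) b])
  ultimately have "K = int_span (of_int (int a) *s v) (?P b (int d))" by blast
  then show ?thesis using that[of "int a" "int d" b] ad by simp
qed

section \<open>Proper isometry classes as residue classes\<close>

text \<open>The action of \<open>diag(t, 1/t)\<close>, which is the general proper isometry of the plane.\<close>

definition stretch :: "rat \<Rightarrow> rat ^ 2 \<Rightarrow> rat ^ 2" where
  "stretch t v = vector [t * v $ 1, v $ 2 / t]"

lemma stretch_nth [simp]: "stretch t v $ 1 = t * v $ 1" "stretch t v $ 2 = v $ 2 / t"
  by (simp_all add: stretch_def)

lemma vec2_eq_iff: "(v :: rat ^ 2) = w \<longleftrightarrow> v $ 1 = w $ 1 \<and> v $ 2 = w $ 2"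
  by (simp add: vec_eq_iff forall_2)

text \<open>The columns of \<open>A\<close> are isotropic and pair to \<open>1/2\<close>, so \<open>A\<close> is diagonal or antidiagonal; the
  antidiagonal matrices have determinant \<open>-1\<close>.\<close>

lemma special_orthogonal_imp_stretch:
  assumes "A \<in> special_orthogonal_group"
  shows "\<exists>t. t \<noteq> 0 \<and> (*v) A = stretch t"
proof -
  define p q r u where "p = A $ 1 $ 1" and "q = A $ 1 $ 2" and "r = A $ 2 $ 1" and "u = A $ 2 $ 2"
  note d = p_def q_def r_def u_def
  have mv: "A *v x = vector [p * x $ 1 + q * x $ 2, r * x $ 1 + u * x $ 2]" for x
    by (simp add: vec2_eq_iff matrix_vector_mult_def sum_2 d)
  have B: "bilin_form (A *v x) (A *v y) = bilin_form x y" for x y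
    using assms by (auto simp: special_orthogonal_group_def orthogonal_group_def)
  have pr: "p * r = 0" and qu: "q * u = 0" and pu: "p * u + q * r = 1"
    using B[of "vector [1,0]" "vector [1,0]"] B[of "vector [0,1]" "vector [0,1]"]
      B[of "vector [1,0]" "vector [0,1]"]
    by (simp_all add: mv bilin_form_def quad_form_def algebra_simps)
  have "det A = 1" using assms by (simp add: special_orthogonal_group_def)
  then have "p * u - q * r = 1" by (simp add: det_2 d)
  then have "p * u = 1" using pu by linarith
  then have nz: "p \<noteq> 0" "u \<noteq> 0" by auto
  then have "r = 0" "q = 0" "u = 1 / p" using pr qu \<open>p * u = 1\<close> by (auto simp: field_simps)
  then show ?thesis using nz by (intro exI[of _ p]) (auto simp: fun_eq_iff mv vec2_eq_iff)
qed

lemma stretch_imp_special_orthogonal: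
  assumes "t \<noteq> 0"
  shows "\<exists>A \<in> special_orthogonal_group. (*v) A = stretch t"
proof
  let ?A = "vector [vector [t, 0], vector [0, 1 / t]] :: rat ^ 2 ^ 2"
  show mv: "(*v) ?A = stretch t"
    by (simp add: fun_eq_iff vec2_eq_iff matrix_vector_mult_def sum_2)
  have det: "det ?A = 1" using assms by (simp add: det_2)
  then have "invertible ?A" by (simp add: invertible_det_nz)
  moreover have "bilin_form (stretch t x) (stretch t y) = bilin_form x y" for x y
    using assms by (simp add: bilin_form_def quad_form_def field_simps)
  ultimately show "?A \<in> special_orthogonal_group"
    using det by (auto simp: special_orthogonal_group_def orthogonal_group_def mv)
qed

lemma properly_isometric_iff:
  "(K1, K2) \<in> properly_isometric \<longleftrightarrow> (\<exists>t. t \<noteq> 0 \<and> stretch t ` K1 = K2)"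
proof
  assume "(K1, K2) \<in> properly_isometric"
  then obtain A where "A \<in> special_orthogonal_group" "(*v) A ` K1 = K2"
    by (auto simp: properly_isometric_def)
  then show "\<exists>t. t \<noteq> 0 \<and> stretch t ` K1 = K2"
    using special_orthogonal_imp_stretch by metis
next
  assume "\<exists>t. t \<noteq> 0 \<and> stretch t ` K1 = K2"
  then show "(K1, K2) \<in> properly_isometric"
    unfolding properly_isometric_def using stretch_imp_special_orthogonal
    by (metis (mono_tags, lifting) case_prodI mem_Collect_eq)
qed

lemma stretch_stretch: "stretch s ` stretch t ` K = stretch (s * t) ` K"
  unfolding image_image by (intro image_cong refl) (simp add: vec2_eq_iff)

lemma stretch_1: "stretch 1 ` K = K"
proof -
  have "stretch 1 = (\<lambda>v. v)" by (simp add: fun_eq_iff vec2_eq_iff)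
  then show ?thesis by simp
qed

lemma equiv_properly_isometric: "equiv UNIV properly_isometric"
proof (rule equivI)
  show "refl properly_isometric"
    by (auto simp: refl_on_def properly_isometric_iff intro!: exI[of _ 1] stretch_1)
  show "sym properly_isometric"
  proof (rule symI)
    fix K1 K2 assume "(K1, K2) \<in> properly_isometric"
    then obtain t where "t \<noteq> 0" "stretch t ` K1 = K2" by (auto simp: properly_isometric_iff)
    then have "stretch (1 / t) ` K2 = K1" using stretch_stretch[of "1 / t" t K1] stretch_1 by auto
    then show "(K2, K1) \<in> properly_isometric"
      using \<open>t \<noteq> 0\<close> by (auto simp: properly_isometric_iff intro!: exI[of _ "1 / t"])
  qed
  show "trans properly_isometric"
  proof (rule transI)
    fix K1 K2 K3 assume "(K1, K2) \<in> properly_isometric" "(K2, K3) \<in> properly_isometric"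
    then obtain s t where "t \<noteq> 0" "stretch t ` K1 = K2" "s \<noteq> 0" "stretch s ` K2 = K3"
      by (auto simp: properly_isometric_iff)
    then have "stretch (s * t) ` K1 = K3" "s * t \<noteq> 0" using stretch_stretch[of s t K1] by auto
    then show "(K1, K3) \<in> properly_isometric" unfolding properly_isometric_iff by blast
  qed
qed simp

lemma stretch_int_span: "stretch t ` int_span v w = int_span (stretch t v) (stretch t w)"
proof -
  have "stretch t (of_int a *s v + of_int b *s w)
      = of_int a *s stretch t v + of_int b *s stretch t w" for a b
    by (simp add: vec2_eq_iff algebra_simps add_divide_distrib)
  moreover have "int_span v w = range (\<lambda>(a, b). of_int a *s v + of_int b *s w)" for v w
    by (auto simp: int_span_def)
  ultimately show ?thesis by (simp add: image_image case_prod_unfold)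
qed

text \<open>The lattices that project onto \<open>\<int>\<close> along the first axis; \<open>A\<close> is the covolume.\<close>

definition normal_lattice :: "int \<Rightarrow> int \<Rightarrow> (rat ^ 2) set" where
  "normal_lattice A x = int_span (vector [of_int A, 0]) (vector [of_int x, 1])"

lemma normal_lattice_iff:
  "v \<in> normal_lattice A x \<longleftrightarrow> (\<exists>p q. v = vector [of_int (p * A + q * x), of_int q])"
  unfolding normal_lattice_def int_span_def by (auto simp: vec2_eq_iff)

lemma normal_lattice_cong:
  assumes "[x = y] (mod A)"
  shows "normal_lattice A x = normal_lattice A y"
proof -
  have sub: "normal_lattice A x \<subseteq> normal_lattice A y" if xy: "[x = y] (mod A)" for x y
  proof
    fix v assume "v \<in> normal_lattice A x"
    then obtain p q where v: "v = vector [of_int (p * A + q * x), of_int q]"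
      by (auto simp: normal_lattice_iff)
    from xy obtain k where "x = y + A * k"
      by (metis cong_iff_lin cong_sym)
    then have "p * A + q * x = (p + q * k) * A + q * y" by (simp add: algebra_simps)
    then show "v \<in> normal_lattice A y" unfolding normal_lattice_iff v by metis
  qed
  then show ?thesis using assms by (metis cong_sym subset_antisym)
qed

text \<open>A stretching between two such lattices must preserve their common projection \<open>\<int>\<close>, which leaves
  \<open>t = 1\<close> and \<open>t = -1\<close>; these map every lattice to itself. So \<open>x\<close> modulo
  \<open>A\<close> is a complete invariant among the lattices of this form with covolume \<open>A\<close>.\<close>

lemma normal_lattice_isometric_iff:
  "(normal_lattice A x, normal_lattice A y) \<in> properly_isometric \<longleftrightarrow> [x = y] (mod A)"
proof
  assume "(normal_lattice A x, normal_lattice A y) \<in> properly_isometric"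
  then obtain t where t: "t \<noteq> 0" "stretch t ` normal_lattice A x = normal_lattice A y"
    by (auto simp: properly_isometric_iff)
  have "(vector [of_int x, 1] :: rat ^ 2) \<in> normal_lattice A x"
    unfolding normal_lattice_iff by (intro exI[of _ 0] exI[of _ 1]) simp
  then have "stretch t (vector [of_int x, 1]) \<in> normal_lattice A y" using t by blast
  then obtain p q where pq: "t * of_int x = of_int (p * A + q * y)" "1 / t = of_int q"
    unfolding normal_lattice_iff by (auto simp: vec2_eq_iff)
  have "(vector [of_int y, 1] :: rat ^ 2) \<in> normal_lattice A y"
    unfolding normal_lattice_iff by (intro exI[of _ 0] exI[of _ 1]) simp
  then obtain v where v: "v \<in> normal_lattice A x" "vector [of_int y, 1] = stretch t v"
    using t by blast
  then obtain p' q' where "v = vector [of_int (p' * A + q' * x), of_int q']"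
    by (auto simp: normal_lattice_iff)
  then have "t = of_int q'" using v t(1) by (simp add: vec2_eq_iff)
  then have qq: "of_int (q * q') = (1 :: rat)" using pq(2) t(1) by (simp add: field_simps)
  then have "q * q' = 1" using of_int_eq_1_iff by blast
  then have "(q = 1 \<and> q' = 1) \<or> (q = -1 \<and> q' = -1)" using zmult_eq_1_iff by blast
  moreover have "(of_int (q' * x) :: rat) = of_int (p * A + q * y)"
    using pq(1) \<open>t = of_int q'\<close> by simp
  then have "q' * x = p * A + q * y" by (simp only: of_int_eq_iff)
  ultimately have "x = y + A * p \<or> x = y + A * (- p)" by (auto simp: algebra_simps)
  then show "[x = y] (mod A)" by (metis cong_iff_lin cong_sym)
next
  assume "[x = y] (mod A)"
  then have "normal_lattice A x = normal_lattice A y" by (rule normal_lattice_cong)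
  then show "(normal_lattice A x, normal_lattice A y) \<in> properly_isometric"
    using equiv_properly_isometric by (simp add: equiv_def refl_on_def)
qed

lemma hyperbolic_plane_eq: "hyperbolic_plane = int_span (axis 1 1) (axis 2 1)"
  by (simp add: hyperbolic_plane_def int_span_def)

text \<open>Reading off the invariant of a sublattice in Hermite normal form: rescaling by \<open>d\<close> makes its
  projection equal to \<open>\<int>\<close> again, at the price of a factor \<open>d\<close> in the first coordinate.\<close>

lemma triangular_eq_stretch_normal:
  assumes "d > 0" "c > 0"
  shows "int_span (of_int a *s stretch (1 / of_int c) (vector [of_int N, 0]))
       (of_int b *s stretch (1 / of_int c) (vector [of_int N, 0])
        + of_int d *s stretch (1 / of_int c) (vector [of_int \<beta>, 1]))
     = stretch (1 / of_int (c * d)) ` normal_lattice (d * a * N) (d * b * N + d\<^sup>2 * \<beta>)"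
  unfolding normal_lattice_def stretch_int_span
  by (intro arg_cong2[where f = int_span])
    (use assms in \<open>simp_all add: vec2_eq_iff field_simps power2_eq_square\<close>)

lemma sublattice_hyperbolic_plane_normal:
  assumes "sublattice L hyperbolic_plane"
  obtains N \<beta> c :: int where "N > 0" "c > 0"
    "L = stretch (1 / of_int c) ` normal_lattice N \<beta>"
proof -
  obtain a b d :: int where abd: "a > 0" "d > 0"
    "L = int_span (of_int a *s axis 1 1) (of_int b *s axis 1 1 + of_int d *s axis 2 1)"
    using sublattice_triangular assms unfolding hyperbolic_plane_eq by metis
  have "L = stretch (1 / of_int d) ` normal_lattice (d * a) (d * b)"
    unfolding abd(3) normal_lattice_def stretch_int_span
    by (intro arg_cong2[where f = int_span])
      (use abd in \<open>simp_all add: vec2_eq_iff axis_def\<close>)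
  then show ?thesis using that[of "d * a" d "d * b"] abd by simp
qed

text \<open>The invariants of the sublattices of index \<open>m\<close> in a lattice with invariants \<open>N\<close> and \<open>\<beta>\<close>. The
  number \<open>k\<close> is the second diagonal entry of the Hermite normal form; several \<open>k\<close> may yield the same
  residue, since one proper isometry class may contain several sublattices.\<close>

definition admissible_residues :: "int \<Rightarrow> int \<Rightarrow> nat \<Rightarrow> int set" where
  "admissible_residues N \<beta> m =
     {x \<in> {0..<int m * N}. \<exists>k>0. k dvd int m \<and> [x = \<beta> * k\<^sup>2] (mod k * N)}"

text \<open>A sublattice with Hermite normal form \<open>a, b, d\<close> and \<open>a d = m\<close> has invariant \<open>d b N + d\<^sup>2 \<beta>\<close>
  modulo \<open>m N\<close>. As \<open>b\<close> runs through the integers, these are the residues congruent to \<open>\<beta> d\<^sup>2\<close>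
  modulo \<open>d N\<close>.\<close>

lemma num_proper_classes_eq:
  assumes "N > 0" "c > 0" and m: "m > 0"
    and L: "L = stretch (1 / of_int c) ` normal_lattice N \<beta>"
  shows "num_proper_classes L m = card (admissible_residues N \<beta> m)"
proof -
  define v1 :: "rat ^ 2" where "v1 = stretch (1 / of_int c) (vector [of_int N, 0])"
  define v2 :: "rat ^ 2" where "v2 = stretch (1 / of_int c) (vector [of_int \<beta>, 1])"
  let ?T = "{K. sublattice K L \<and> lattice_index L K = m}"
  let ?C = "\<lambda>x. properly_isometric `` {normal_lattice (int m * N) x}"
  have L': "L = int_span v1 v2"
    unfolding L normal_lattice_def stretch_int_span v1_def v2_def ..
  have ind: "int_independent v1 v2"
    using assms by (auto simp: int_independent_def vec2_eq_iff v1_def v2_def)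
  have tri: "properly_isometric `` {int_span (of_int a *s v1) (of_int b *s v1 + of_int d *s v2)}
      = ?C (d * b * N + d\<^sup>2 * \<beta>)" if "d > 0" "d * a = int m" for a b d
  proof -
    have "(normal_lattice (int m * N) (d * b * N + d\<^sup>2 * \<beta>),
        int_span (of_int a *s v1) (of_int b *s v1 + of_int d *s v2)) \<in> properly_isometric"
      unfolding v1_def v2_def triangular_eq_stretch_normal[OF \<open>d > 0\<close> \<open>c > 0\<close>]
      unfolding properly_isometric_iff that(2) using that(1) \<open>c > 0\<close>
      by (intro exI[of _ "1 / of_int (c * d)"]) simp
    then show ?thesis using equiv_class_eq[OF equiv_properly_isometric] by metis
  qed
  have "?T // properly_isometric = ?C ` admissible_residues N \<beta> m"
  proof (intro equalityI subsetI)
    fix X assume "X \<in> ?T // properly_isometric"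
    then obtain K where K: "sublattice K L" "lattice_index L K = m"
      and X: "X = properly_isometric `` {K}" by (auto elim!: quotientE)
    obtain a b d where abd: "a > 0" "d > 0"
      and Keq: "K = int_span (of_int a *s v1) (of_int b *s v1 + of_int d *s v2)"
      using sublattice_triangular K(1) unfolding L' by metis
    have "m = nat (a * d)"
      using triangular_sublattice(2)[OF ind abd, of b] K(2) unfolding Keq L' by simp
    then have m_eq: "d * a = int m" using abd by simp
    define x0 where "x0 = d * b * N + d\<^sup>2 * \<beta>"
    define x where "x = x0 mod (int m * N)"
    have cong: "[x = x0] (mod int m * N)" by (simp add: x_def)
    have "d * N dvd int m * N" using m_eq by (metis dvd_triv_left mult_dvd_mono dvd_refl)
    then have "[x = x0] (mod d * N)" using cong cong_dvd_modulus by blast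
    moreover have "[x0 = \<beta> * d\<^sup>2] (mod d * N)"
      unfolding x0_def by (simp add: cong_iff_dvd_diff algebra_simps)
    ultimately have "[x = \<beta> * d\<^sup>2] (mod d * N)" by (rule cong_trans)
    moreover have "x \<in> {0..<int m * N}" using m \<open>N > 0\<close> by (simp add: x_def)
    moreover have "d dvd int m" by (metis m_eq dvd_triv_left)
    ultimately have "x \<in> admissible_residues N \<beta> m"
      using abd(2) unfolding admissible_residues_def by blast
    moreover have "X = ?C x"
      unfolding X Keq tri[OF abd(2) m_eq] x0_def[symmetric] normal_lattice_cong[OF cong] ..
    ultimately show "X \<in> ?C ` admissible_residues N \<beta> m" by blast
  next
    fix X assume "X \<in> ?C ` admissible_residues N \<beta> m"
    then obtain x where x: "x \<in> admissible_residues N \<beta> m" and X: "X = ?C x" by blast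
    then obtain d where d: "d > 0" "d dvd int m" "[x = \<beta> * d\<^sup>2] (mod d * N)"
      by (auto simp: admissible_residues_def)
    then obtain a where a: "int m = d * a" by blast
    have "a > 0" using a d m by (metis of_nat_0_less_iff zero_less_mult_pos)
    obtain b where "x = \<beta> * d\<^sup>2 + d * N * b" using d(3) by (metis cong_iff_lin cong_sym)
    then have b: "x = d * b * N + d\<^sup>2 * \<beta>" by simp
    let ?K = "int_span (of_int a *s v1) (of_int b *s v1 + of_int d *s v2)"
    have "?K \<in> ?T"
      using triangular_sublattice[OF ind \<open>a > 0\<close> \<open>d > 0\<close>, of b] a unfolding L'
      by (simp add: mult.commute)
    moreover have "properly_isometric `` {?K} = X" unfolding X b using tri d(1) a by simp
    ultimately show "X \<in> ?T // properly_isometric" using quotientI by metis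
  qed
  moreover have "inj_on ?C (admissible_residues N \<beta> m)"
  proof (rule inj_onI)
    fix x y assume xy: "x \<in> admissible_residues N \<beta> m" "y \<in> admissible_residues N \<beta> m"
      and "?C x = ?C y"
    then have "[x = y] (mod int m * N)"
      using eq_equiv_class_iff[OF equiv_properly_isometric] normal_lattice_isometric_iff by auto
    then show "x = y" using xy by (simp add: admissible_residues_def unique_euclidean_semiring_class.cong_def)
  qed
  ultimately show ?thesis unfolding num_proper_classes_def by (simp add: card_image)
qed

section \<open>Sorting residues by their greatest common divisor with the modulus\<close>

definition moebius_mu :: "nat \<Rightarrow> int" where
  "moebius_mu n = (if squarefree n then (-1) ^ card (prime_factors n) else 0)"

lemma abs_moebius_mu_le_1: "\<bar>moebius_mu n\<bar> \<le> 1"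
  by (simp add: moebius_mu_def power_abs)

lemma moebius_mu_prime_mult:
  assumes "prime p" "\<not> p dvd d" "squarefree d"
  shows "moebius_mu (p * d) = - moebius_mu d" "squarefree (p * d)"
proof -
  have d: "d \<noteq> 0" using assms by (metis dvd_0_right)
  have cop: "coprime p d" using assms prime_imp_coprime by blast
  then show sf: "squarefree (p * d)"
    using assms squarefree_mult_coprime squarefree_prime by blast
  have "prime_factors (p * d) = insert p (prime_factors d)"
    using assms d by (simp add: prime_factors_product prime_prime_factors)
  moreover have "p \<notin> prime_factors d" using assms by auto
  ultimately show "moebius_mu (p * d) = - moebius_mu d"
    using sf assms by (simp add: moebius_mu_def)
qed

text \<open>For a prime \<open>p\<close> dividing \<open>n\<close>, the squarefree divisors of \<open>n\<close> come in pairs \<open>d\<close>, \<open>p d\<close> with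
  opposite signs.\<close>

lemma sum_moebius_mu:
  assumes "n > 0"
  shows "(\<Sum>d | d dvd n. moebius_mu d) = (if n = 1 then 1 else 0)"
proof (cases "n = 1")
  case True
  then show ?thesis by (simp add: moebius_mu_def)
next
  case False
  then obtain p where p: "prime p" "p dvd n" using prime_factor_nat by blast
  have fin: "finite {d. d dvd n}" using assms by simp
  define A where "A = {d. d dvd n \<and> squarefree d \<and> \<not> p dvd d}"
  have finA: "finite A" unfolding A_def by (rule finite_subset[OF _ fin]) auto
  have "(\<Sum>d | d dvd n. moebius_mu d) = (\<Sum>d\<in>A \<union> (*) p ` A. moebius_mu d)"
  proof (rule sum.mono_neutral_right[OF fin])
    have "p * d dvd n" if "d \<in> A" for d
      using that p by (auto simp: A_def intro!: divides_mult prime_imp_coprime)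
    then show "A \<union> (*) p ` A \<subseteq> {d. d dvd n}" by (auto simp: A_def)
    show "\<forall>d \<in> {d. d dvd n} - (A \<union> (*) p ` A). moebius_mu d = 0"
    proof (intro ballI, rule ccontr)
      fix d assume d: "d \<in> {d. d dvd n} - (A \<union> (*) p ` A)" and "moebius_mu d \<noteq> 0"
      then have sf: "squarefree d" by (auto simp: moebius_mu_def split: if_splits)
      then have "p dvd d" using d by (auto simp: A_def)
      then obtain d' where d': "d = p * d'" by blast
      have "\<not> p dvd d'"
      proof
        assume "p dvd d'"
        then have "p ^ 2 dvd d" unfolding d' power2_eq_square by (rule mult_dvd_mono[OF dvd_refl])
        then show False using sf p by (metis squarefreeD not_prime_unit)
      qed
      moreover have "squarefree d'" using sf unfolding d' by (metis squarefree_multD(2))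
      moreover have "d' dvd n" using d unfolding d' by (auto intro: dvd_trans)
      ultimately have "d' \<in> A" by (simp add: A_def)
      then show False using d d' by blast
    qed
  qed
  also have "\<dots> = (\<Sum>d\<in>A. moebius_mu d) + (\<Sum>d\<in>(*) p ` A. moebius_mu d)"
    by (rule sum.union_disjoint) (use finA in \<open>auto simp: A_def\<close>)
  also have "(\<Sum>d\<in>(*) p ` A. moebius_mu d) = (\<Sum>d\<in>A. moebius_mu (p * d))"
    by (rule sum.reindex_cong[where l = "(*) p"]) (use p in \<open>auto simp: inj_on_def\<close>)
  also have "\<dots> = (\<Sum>d\<in>A. - moebius_mu d)"
    by (rule sum.cong) (use p moebius_mu_prime_mult(1) in \<open>auto simp: A_def\<close>)
  finally show ?thesis using False by (simp add: sum_negf)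
qed

lemma card_periodic:
  fixes Q :: "nat \<Rightarrow> bool"
  assumes per: "\<And>i. Q (i + p) = Q i"
  shows "card {i. i < p * q \<and> Q i} = q * card {i. i < p \<and> Q i}"
proof (induction q)
  case 0
  then show ?case by simp
next
  case (Suc q)
  have Q: "Q (i + p * k) = Q i" for i k
  proof (induction k)
    case (Suc k)
    have "i + p * Suc k = i + p * k + p" by simp
    then show ?case using per[of "i + p * k"] Suc by metis
  qed simp
  have shift: "{i. p * q \<le> i \<and> i < p * Suc q \<and> Q i} = (\<lambda>i. i + p * q) ` {i. i < p \<and> Q i}"
  proof (intro equalityI subsetI)
    fix i assume i: "i \<in> {i. p * q \<le> i \<and> i < p * Suc q \<and> Q i}"
    then have "i = (i - p * q) + p * q" "i - p * q < p" by auto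
    moreover have "Q (i - p * q)" using i Q[of "i - p * q" q] by simp
    ultimately show "i \<in> (\<lambda>i. i + p * q) ` {i. i < p \<and> Q i}" by blast
  qed (use Q in auto)
  have un: "{i. i < p * Suc q \<and> Q i} = {i. i < p * q \<and> Q i} \<union> {i. p * q \<le> i \<and> i < p * Suc q \<and> Q i}"
    by auto
  have "card {i. i < p * Suc q \<and> Q i}
      = card {i. i < p * q \<and> Q i} + card {i. p * q \<le> i \<and> i < p * Suc q \<and> Q i}"
    unfolding un by (rule card_Un_disjoint) auto
  then show ?case unfolding shift Suc by (simp add: card_image inj_on_def)
qed

text \<open>The admissibility of \<open>x = D b\<close> modulo \<open>n = D a\<close>, with \<open>k\<close> a divisor of \<open>D\<close> and its conditions
  divided by \<open>k\<close>. In this form it depends on \<open>a\<close> and \<open>b\<close> only modulo \<open>N\<close>, and it makes sense even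
  if \<open>a\<close> and \<open>b\<close> are not coprime.\<close>

definition fits :: "nat \<Rightarrow> int \<Rightarrow> nat \<Rightarrow> nat \<Rightarrow> nat \<Rightarrow> bool" where
  "fits N \<beta> D a b \<longleftrightarrow>
     (\<exists>t k. t * k = D \<and> N dvd t * a \<and> [int (t * b) = \<beta> * int k] (mod int N))"

lemma fits_cong:
  assumes "[a = a'] (mod N)" "[b = b'] (mod N)"
  shows "fits N \<beta> D a b \<longleftrightarrow> fits N \<beta> D a' b'"
proof -
  have "N dvd t * a \<longleftrightarrow> N dvd t * a'" for t
    using assms(1) by (metis cong_dvd_iff cong_scalar_left)
  moreover have "[int (t * b) = int (t * b')] (mod int N)" for t
    using assms(2) by (simp add: cong_int_iff cong_scalar_left del: of_nat_mult)
  then have "[int (t * b) = z] (mod int N) \<longleftrightarrow> [int (t * b') = z] (mod int N)" for t z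
    by (metis cong_sym cong_trans)
  ultimately show ?thesis unfolding fits_def by presburger
qed

text \<open>A second period: the condition \<open>N dvd t * a\<close> makes \<open>t * b\<close> modulo \<open>N\<close> depend on \<open>b\<close> only
  modulo \<open>a\<close>.\<close>

lemma fits_shift: "fits N \<beta> D (e * f) (e * (i + f)) \<longleftrightarrow> fits N \<beta> D (e * f) (e * i)"
proof -
  have "[int (t * (e * (i + f))) = int (t * (e * i))] (mod int N)" if "N dvd t * (e * f)" for t
  proof -
    have "[t * (e * i) + t * (e * f) = t * (e * i) + 0] (mod N)"
      using that by (intro cong_add) (simp_all add: cong_0_iff)
    then have "[t * (e * (i + f)) = t * (e * i)] (mod N)" by (simp add: algebra_simps)
    then show ?thesis by (simp add: cong_int_iff del: of_nat_mult)
  qed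
  then have "N dvd t * (e * f) \<and> [int (t * (e * (i + f))) = z] (mod int N)
      \<longleftrightarrow> N dvd t * (e * f) \<and> [int (t * (e * i)) = z] (mod int N)" for t z
    by (metis cong_sym cong_trans)
  then show ?thesis unfolding fits_def by presburger
qed

definition fit_count :: "nat \<Rightarrow> int \<Rightarrow> nat \<Rightarrow> nat \<Rightarrow> nat \<Rightarrow> nat" where
  "fit_count N \<beta> D e f = card {i. i < N \<and> fits N \<beta> D (e * f) (e * i)}"

lemma fit_count_le: "fit_count N \<beta> D e f \<le> N"
proof -
  have "fit_count N \<beta> D e f \<le> card {..<N}"
    unfolding fit_count_def by (rule card_mono) auto
  then show ?thesis by simp
qed

lemma fit_count_cong:
  assumes "[f = f'] (mod N)"
  shows "fit_count N \<beta> D e f = fit_count N \<beta> D e f'"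
proof -
  have "[e * f = e * f'] (mod N)" using assms by (rule cong_scalar_left)
  then have "fits N \<beta> D (e * f) (e * i) = fits N \<beta> D (e * f') (e * i)" for i
    by (rule fits_cong) simp
  then show ?thesis by (simp add: fit_count_def)
qed

text \<open>The counted set has both periods \<open>f\<close> and \<open>N\<close>, and the two sides are its number of
  elements in an interval of length \<open>f N\<close>. So the count up to \<open>f\<close> is exactly linear in \<open>f\<close> once
  \<open>f\<close> modulo \<open>N\<close> is fixed, with no error term.\<close>

lemma card_fits: "N * card {i. i < f \<and> fits N \<beta> D (e * f) (e * i)} = f * fit_count N \<beta> D e f"
proof -
  let ?Q = "\<lambda>i. fits N \<beta> D (e * f) (e * i)"
  have "?Q (i + f) = ?Q i" for i by (rule fits_shift)
  then have "card {i. i < f * N \<and> ?Q i} = N * card {i. i < f \<and> ?Q i}" by (rule card_periodic)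
  moreover have "?Q (i + N) = ?Q i" for i
    by (rule fits_cong) (simp_all add: unique_euclidean_semiring_class.cong_def distrib_left)
  then have "card {i. i < N * f \<and> ?Q i} = f * card {i. i < N \<and> ?Q i}" by (rule card_periodic)
  ultimately show ?thesis by (simp add: fit_count_def mult.commute)
qed

text \<open>Moebius inversion: the indicator of \<open>D = gcd x n\<close> is the sum of the Moebius function over those
  \<open>e\<close> for which \<open>D * e\<close> divides both \<open>x\<close> and \<open>n\<close>. After exchanging the sums, the substitution
  \<open>x = D e i\<close> leaves an unrestricted count of \<open>i\<close>.\<close>

lemma card_fits_gcd:
  assumes "n > 0"
  shows "int (card {x. x < n \<and> fits N \<beta> (gcd x n) (n div gcd x n) (x div gcd x n)})
    = (\<Sum>(D, e) | D * e dvd n. moebius_mu e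
          * int (card {i. i < n div (D * e) \<and> fits N \<beta> D (e * (n div (D * e))) (e * i)}))"
proof -
  define S where "S = {(D, e). D * e dvd n}"
  have "S \<subseteq> {..n} \<times> {..n}"
  proof
    fix z assume "z \<in> S"
    then obtain D e where z: "z = (D, e)" "D * e dvd n" by (auto simp: S_def)
    then have "D dvd n" "e dvd n" by (metis dvd_mult_left, metis dvd_mult_right)
    then show "z \<in> {..n} \<times> {..n}" using assms z(1) by (auto intro: dvd_imp_le)
  qed
  then have finS: "finite S" by (rule finite_subset) simp
  have inner: "(if fits N \<beta> (gcd x n) (n div gcd x n) (x div gcd x n) then 1 else 0)
      = (\<Sum>(D, e)\<in>S. if D * e dvd x \<and> fits N \<beta> D (n div D) (x div D) then moebius_mu e else 0)" for x
  proof -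
    define g where "g = gcd x n"
    have g0: "g > 0" using assms by (simp add: g_def)
    let ?F = "\<lambda>D. fits N \<beta> D (n div D) (x div D)"
    have eq: "{z \<in> S. case z of (D, e) \<Rightarrow> D * e dvd x}
        = (SIGMA D:{D. D dvd g}. {e. e dvd g div D})"
    proof -
      have "D * e dvd n \<and> D * e dvd x \<longleftrightarrow> D dvd g \<and> e dvd g div D" for D e
      proof
        assume "D * e dvd n \<and> D * e dvd x"
        then have "D * e dvd g" by (simp add: g_def)
        then show "D dvd g \<and> e dvd g div D" using g0
          by (metis dvd_mult_left dvd_mult_imp_div mult.commute)
      next
        assume "D dvd g \<and> e dvd g div D"
        then have "D * e dvd g" using g0
          by (metis dvd_mult_div_cancel mult_dvd_mono dvd_refl)
        then show "D * e dvd n \<and> D * e dvd x" by (simp add: g_def)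
      qed
      then show ?thesis by (auto simp: S_def)
    qed
    have "(\<Sum>(D, e)\<in>S. if D * e dvd x \<and> ?F D then moebius_mu e else 0)
        = (\<Sum>(D, e)\<in>{z \<in> S. case z of (D, e) \<Rightarrow> D * e dvd x}. if ?F D then moebius_mu e else 0)"
      by (rule sum.mono_neutral_cong_right[OF finS]) (auto split: if_splits)
    also have "\<dots> = (\<Sum>D | D dvd g. \<Sum>e | e dvd g div D. if ?F D then moebius_mu e else 0)"
      unfolding eq by (rule sum.Sigma[symmetric]) (use g0 in \<open>auto elim!: dvdE\<close>)
    also have "\<dots> = (\<Sum>D | D dvd g. if D = g \<and> ?F g then 1 else 0)"
    proof (rule sum.cong, simp)
      fix D assume "D \<in> {D. D dvd g}"
      then have D: "D dvd g" by simp
      then have "g div D > 0" "g div D = 1 \<longleftrightarrow> D = g"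
        using g0 by (auto elim!: dvdE)
      then show "(\<Sum>e | e dvd g div D. if ?F D then moebius_mu e else 0)
          = (if D = g \<and> ?F g then 1 else 0)"
        using sum_moebius_mu[of "g div D"] by (cases "?F D") auto
    qed
    also have "\<dots> = (if ?F g then 1 else 0)"
    proof (cases "?F g")
      case True
      then show ?thesis using g0 by (simp add: sum.delta)
    qed simp
    finally show ?thesis by (simp add: g_def)
  qed
  have count: "card {x. x < n \<and> D * e dvd x \<and> fits N \<beta> D (n div D) (x div D)}
      = card {i. i < n div (D * e) \<and> fits N \<beta> D (e * (n div (D * e))) (e * i)}"
    if DE: "(D, e) \<in> S" for D e
  proof -
    obtain f where f: "n = D * e * f" using DE unfolding S_def dvd_def by auto
    then have pos: "D > 0" "e > 0" "f > 0" using assms by auto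
    have "{x. x < n \<and> D * e dvd x \<and> fits N \<beta> D (n div D) (x div D)}
        = (*) (D * e) ` {i. i < f \<and> fits N \<beta> D (e * f) (e * i)}"
      using pos by (auto simp: f image_iff mult.assoc elim!: dvdE)
    moreover have "inj_on ((*) (D * e)) A" for A using pos by (auto simp: inj_on_def)
    ultimately show ?thesis using pos by (simp add: card_image f)
  qed
  have "int (card {x. x < n \<and> fits N \<beta> (gcd x n) (n div gcd x n) (x div gcd x n)})
      = (\<Sum>x<n. if fits N \<beta> (gcd x n) (n div gcd x n) (x div gcd x n) then 1 else 0)"
    by (simp add: sum.If_cases lessThan_def Int_def conj_commute)
  also have "\<dots> = (\<Sum>x<n. \<Sum>(D, e)\<in>S.
      if D * e dvd x \<and> fits N \<beta> D (n div D) (x div D) then moebius_mu e else 0)"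
    unfolding inner ..
  also have "\<dots> = (\<Sum>(D, e)\<in>S. \<Sum>x<n.
      if D * e dvd x \<and> fits N \<beta> D (n div D) (x div D) then moebius_mu e else 0)"
    by (subst sum.swap) (simp add: case_prod_unfold)
  also have "\<dots> = (\<Sum>(D, e)\<in>S. moebius_mu e
      * int (card {x. x < n \<and> D * e dvd x \<and> fits N \<beta> D (n div D) (x div D)}))"
    by (intro sum.cong refl)
      (auto simp: sum.If_cases lessThan_def Int_def conj_commute mult.commute)
  also have "\<dots> = (\<Sum>(D, e)\<in>S. moebius_mu e
          * int (card {i. i < n div (D * e) \<and> fits N \<beta> D (e * (n div (D * e))) (e * i)}))"
    by (intro sum.cong refl) (use count in auto)
  finally show ?thesis by (simp add: S_def)
qed

text \<open>If \<open>k\<close> divides \<open>m\<close> and \<open>x \<equiv> \<beta> k\<^sup>2\<close> modulo \<open>k N\<close>, then \<open>k\<close> divides \<open>x\<close>, and therefore \<open>gcd x n\<close>.\<close>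

lemma fits_gcd_iff:
  assumes "m > 0" "N > 0"
  defines "n \<equiv> m * N"
  shows "fits N \<beta> (gcd x n) (n div gcd x n) (x div gcd x n) \<longleftrightarrow>
    (\<exists>k>0. k dvd m \<and> [int x = \<beta> * (int k)\<^sup>2] (mod int (k * N)))"
proof -
  define g where "g = gcd x n"
  have g0: "g > 0" using assms by (simp add: g_def)
  obtain a b where ab: "n = g * a" "x = g * b" by (metis dvdE gcd_dvd1 gcd_dvd2 g_def)
  have "fits N \<beta> g a b \<longleftrightarrow> (\<exists>k>0. k dvd m \<and> [int x = \<beta> * (int k)\<^sup>2] (mod int (k * N)))"
  proof
    assume "fits N \<beta> g a b"
    then obtain t k where tk: "t * k = g" "N dvd t * a" "[int (t * b) = \<beta> * int k] (mod int N)"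
      by (auto simp: fits_def)
    have "k * N dvd k * (t * a)" using tk(2) by simp
    also have "k * (t * a) = m * N" using ab(1) tk(1) n_def by (simp add: algebra_simps)
    finally have "k dvd m" using assms by simp
    moreover have "k > 0" using tk g0 by (metis gr0I mult_0_right)
    moreover have "int k * int N dvd int k * (int (t * b) - \<beta> * int k)"
      using tk(3) by (simp add: cong_iff_dvd_diff)
    then have "int (k * N) dvd int x - \<beta> * (int k)\<^sup>2"
      unfolding ab(2) tk(1)[symmetric] by (simp add: algebra_simps power2_eq_square)
    ultimately show "\<exists>k>0. k dvd m \<and> [int x = \<beta> * (int k)\<^sup>2] (mod int (k * N))"
      by (auto simp: cong_iff_dvd_diff)
  next
    assume "\<exists>k>0. k dvd m \<and> [int x = \<beta> * (int k)\<^sup>2] (mod int (k * N))"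
    then obtain k where k: "k > 0" "k dvd m" "int (k * N) dvd int x - \<beta> * (int k)\<^sup>2"
      by (auto simp: cong_iff_dvd_diff)
    have "int k dvd int (k * N)" by simp
    then have "int k dvd int x - \<beta> * (int k)\<^sup>2" using k(3) dvd_trans by blast
    moreover have "int k dvd \<beta> * (int k)\<^sup>2" by (simp add: power2_eq_square)
    ultimately have "int k dvd int x - \<beta> * (int k)\<^sup>2 + \<beta> * (int k)\<^sup>2" by (rule dvd_add)
    then have "k dvd x" by (simp only: diff_add_cancel int_dvd_int_iff)
    moreover have "k dvd n" using k(2) by (simp add: n_def)
    ultimately have "k dvd g" by (simp add: g_def)
    then obtain t where t: "g = k * t" by blast
    have "k * N dvd m * N" using k(2) by (simp add: mult_dvd_mono)
    also have "m * N = k * (t * a)" using ab(1) t n_def by simp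
    finally have "N dvd t * a" using k(1) by simp
    moreover have "int k * int N dvd int k * (int (t * b) - \<beta> * int k)"
      using k(3) unfolding ab(2) t by (simp add: algebra_simps power2_eq_square)
    then have "[int (t * b) = \<beta> * int k] (mod int N)"
      using k(1) by (simp add: cong_iff_dvd_diff)
    ultimately show "fits N \<beta> g a b" unfolding fits_def using t by (metis mult.commute)
  qed
  moreover have "n div g = a" "x div g = b" using g0 ab by simp_all
  ultimately show ?thesis unfolding g_def[symmetric] by (simp only:)
qed

text \<open>The convolution below runs over all moduli \<open>n\<close>; those that are not of the form \<open>m N\<close>
  contribute nothing.\<close>

lemma not_fits_gcd:
  assumes "\<not> N dvd n"
  shows "\<not> fits N \<beta> (gcd x n) (n div gcd x n) b"
proof
  assume "fits N \<beta> (gcd x n) (n div gcd x n) b"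
  then obtain t k where "t * k = gcd x n" "N dvd t * (n div gcd x n)" by (auto simp: fits_def)
  then have "N dvd k * (t * (n div gcd x n))" by simp
  also have "k * (t * (n div gcd x n)) = gcd x n * (n div gcd x n)"
    using \<open>t * k = gcd x n\<close> by (metis mult.assoc mult.commute)
  finally show False using assms by simp
qed

section \<open>Holomorphic families of series and zeta functions of arithmetic progressions\<close>

lemma holomorphic_on_infsum:
  fixes f :: "'i \<Rightarrow> complex \<Rightarrow> complex"
  assumes "open S" and hol: "\<And>i. i \<in> I \<Longrightarrow> f i holomorphic_on S"
    and dom: "\<And>z. z \<in> S \<Longrightarrow> \<exists>r>0. \<exists>M. cball z r \<subseteq> S \<and> M summable_on I \<and>
                 (\<forall>i\<in>I. \<forall>w\<in>cball z r. norm (f i w) \<le> M i)"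
  shows "(\<lambda>z. \<Sum>\<^sub>\<infinity>i\<in>I. f i z) holomorphic_on S"
  unfolding holomorphic_on_open[OF \<open>open S\<close>]
proof
  fix z assume "z \<in> S"
  then obtain r M where r: "r > 0" "cball z r \<subseteq> S" and M: "M summable_on I"
    and bound: "\<And>i w. i \<in> I \<Longrightarrow> w \<in> cball z r \<Longrightarrow> norm (f i w) \<le> M i"
    using dom by blast
  have "\<forall>\<^sub>F X in finite_subsets_at_top I. continuous_on (cball z r) (\<lambda>w. \<Sum>i\<in>X. f i w) \<and>
      (\<lambda>w. \<Sum>i\<in>X. f i w) holomorphic_on ball z r"
  proof (rule eventually_finite_subsets_at_top_weakI)
    fix X assume X: "finite X" "X \<subseteq> I"
    have "(\<lambda>w. \<Sum>i\<in>X. f i w) holomorphic_on cball z r"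
      using X hol r by (intro holomorphic_on_sum) (meson holomorphic_on_subset subsetD)
    then show "continuous_on (cball z r) (\<lambda>w. \<Sum>i\<in>X. f i w) \<and>
        (\<lambda>w. \<Sum>i\<in>X. f i w) holomorphic_on ball z r"
      using holomorphic_on_imp_continuous_on holomorphic_on_subset ball_subset_cball by blast
  qed
  moreover have "uniform_limit (cball z r) (\<lambda>X w. \<Sum>i\<in>X. f i w) (\<lambda>w. \<Sum>\<^sub>\<infinity>i\<in>I. f i w)
      (finite_subsets_at_top I)"
    using bound M by (rule Weierstrass_m_test_general)
  ultimately have "(\<lambda>w. \<Sum>\<^sub>\<infinity>i\<in>I. f i w) holomorphic_on ball z r"
    by (rule holomorphic_uniform_limit) simp_all
  then show "\<exists>f'. ((\<lambda>z. \<Sum>\<^sub>\<infinity>i\<in>I. f i z) has_field_derivative f') (at z)"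
    using r(1) by (simp add: holomorphic_on_open)
qed

lemma norm_powr_real_le:
  assumes "x \<ge> 1" "\<sigma> \<le> Re s"
  shows "norm (of_real x powr (- s)) \<le> x powr (- \<sigma>)"
  using assms by (simp add: norm_powr_real_powr powr_mono)

lemma cball_half_plane:
  assumes "a < Re z" "w \<in> cball z ((Re z - a) / 2)"
  shows "(Re z + a) / 2 \<le> Re w"
proof -
  have "\<bar>Re (z - w)\<bar> \<le> (Re z - a) / 2"
    using abs_Re_le_cmod[of "z - w"] assms(2) by (simp add: dist_norm)
  then have "Re z - Re w \<le> (Re z - a) / 2"
    using abs_ge_self[of "Re (z - w)"] unfolding minus_complex.sel by linarith
  then show ?thesis unfolding diff_divide_distrib add_divide_distrib by linarith
qed

text \<open>Dirichlet series with an arbitrary index set, so that the double series over \<open>(D, e)\<close> need not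
  be rearranged into a series over the product \<open>D e\<close>.\<close>

lemma holomorphic_on_dirichlet_infsum:
  fixes c :: "'i \<Rightarrow> complex" and l :: "'i \<Rightarrow> real"
  assumes l: "\<And>i. i \<in> I \<Longrightarrow> l i \<ge> 1"
    and sm: "\<And>\<sigma>. \<sigma> > a \<Longrightarrow> (\<lambda>i. norm (c i) * l i powr (- \<sigma>)) summable_on I"
  shows "(\<lambda>s. \<Sum>\<^sub>\<infinity>i\<in>I. c i * of_real (l i) powr (- s)) holomorphic_on {s. Re s > a}"
proof (rule holomorphic_on_infsum)
  show "open {s. Re s > a}" by (rule open_halfspace_Re_gt)
  show "(\<lambda>s. c i * of_real (l i) powr (- s)) holomorphic_on {s. Re s > a}" if "i \<in> I" for i
    using l[OF that] by (auto intro!: holomorphic_intros)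
  fix z assume z: "z \<in> {s. Re s > a}"
  define \<sigma> where "\<sigma> = (Re z + a) / 2"
  define r where "r = (Re z - a) / 2"
  have "\<sigma> > a" "r > 0" using z by (auto simp: \<sigma>_def r_def field_simps)
  have re: "\<sigma> \<le> Re w" if "w \<in> cball z r" for w
    using cball_half_plane[of a z w] z that by (simp add: \<sigma>_def r_def)
  have "cball z r \<subseteq> {s. Re s > a}" using re \<open>\<sigma> > a\<close> by fastforce
  moreover have "norm (c i * of_real (l i) powr (- w)) \<le> norm (c i) * l i powr (- \<sigma>)"
    if "i \<in> I" "w \<in> cball z r" for i w
    unfolding norm_mult by (intro mult_left_mono norm_powr_real_le l re that) simp
  ultimately show "\<exists>r>0. \<exists>M. cball z r \<subseteq> {s. Re s > a} \<and> M summable_on I \<and>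
      (\<forall>i\<in>I. \<forall>w\<in>cball z r. norm (c i * of_real (l i) powr (- w)) \<le> M i)"
    using \<open>r > 0\<close> sm[OF \<open>\<sigma> > a\<close>] by blast
qed

text \<open>The quantity inside the norm is the first-order Taylor remainder of \<open>z \<mapsto> z\<^sup>1\<^sup>-\<^sup>w\<close> for
  a step \<open>N\<close>.\<close>

lemma powr_Taylor_remainder_bound:
  assumes y: "y > 0" and N: "N > 0" and w: "Re w > 0"
  shows "norm (of_real N * (w - 1) * of_real y powr (- w)
        + of_real (y + N) powr (1 - w) - of_real y powr (1 - w))
      \<le> N\<^sup>2 * norm w * norm (w - 1) * y powr (- Re w - 1)"
proof -
  define S where "S = closed_segment (of_real y :: complex) (of_real (y + N))"
  define f :: "nat \<Rightarrow> complex \<Rightarrow> complex" where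
    "f = (\<lambda>i z. if i = 0 then z powr (1 - w) else if i = 1 then (1 - w) * z powr (- w)
            else (1 - w) * (- w) * z powr (- w - 1))"
  have S: "\<exists>x\<ge>y. z = of_real x" if z: "z \<in> S" for z
  proof -
    obtain u where u: "0 \<le> u" "u \<le> 1"
      "z = (1 - u) *\<^sub>R complex_of_real y + u *\<^sub>R complex_of_real (y + N)"
      using z unfolding S_def in_segment by blast
    then have "z = of_real (y + u * N)" by (simp add: scaleR_conv_of_real algebra_simps)
    moreover have "y + u * N \<ge> y" using u N by simp
    ultimately show ?thesis by blast
  qed
  have pos: "z \<notin> \<real>\<^sub>\<le>\<^sub>0" if "z \<in> S" for z
    using S[OF that] y by (auto simp: complex_nonpos_Reals_iff)
  have "cmod (f 0 (of_real (y + N)) - (\<Sum>i\<le>1. f i (of_real y) * (of_real (y + N) - of_real y) ^ i / (fact i)))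
      \<le> (norm w * norm (w - 1) * y powr (- Re w - 1))
          * cmod (of_real (y + N) - of_real y) ^ (Suc 1) / fact 1"
  proof (rule complex_Taylor)
    show "convex S" by (simp add: S_def)
    show "of_real y \<in> S" "of_real (y + N) \<in> S" by (simp_all add: S_def)
    show "(f i has_field_derivative f (Suc i) z) (at z within S)" if z: "z \<in> S" and "i \<le> 1" for i z
    proof -
      have "i = 0 \<or> i = 1" using \<open>i \<le> 1\<close> by auto
      then show ?thesis
      proof
        assume "i = 0"
        have "((\<lambda>z. z powr (1 - w)) has_field_derivative (1 - w) * z powr (1 - w - 1)) (at z within S)"
          by (rule has_field_derivative_at_within, rule has_field_derivative_powr[OF pos[OF z]])
        then show ?thesis using \<open>i = 0\<close> by (simp add: f_def)
      next
        assume "i = 1"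
        have "((\<lambda>z. z powr (- w)) has_field_derivative (- w) * z powr (- w - 1)) (at z within S)"
          by (rule has_field_derivative_at_within, rule has_field_derivative_powr[OF pos[OF z]])
        from DERIV_cmult[OF this, of "1 - w"] show ?thesis
          using \<open>i = 1\<close> by (simp add: f_def mult.assoc)
      qed
    qed
    show "cmod (f (Suc 1) z) \<le> norm w * norm (w - 1) * y powr (- Re w - 1)" if z: "z \<in> S" for z
    proof -
      obtain x where x: "x \<ge> y" "z = of_real x" using S[OF z] by blast
      have "x powr (- Re w - 1) \<le> y powr (- Re w - 1)"
        using x y w by (intro powr_mono2') auto
      then have "norm (z powr (- w - 1)) \<le> y powr (- Re w - 1)"
        using x y by (simp add: norm_powr_real_powr)
      then show ?thesis
        by (simp add: f_def norm_mult norm_minus_commute mult.commute mult_left_mono)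
    qed
  qed
  then show ?thesis
    using N by (simp add: f_def norm_mult algebra_simps power2_eq_square)
qed

lemma summable_on_powr_shift:
  assumes "\<sigma> > 1"
  shows "(\<lambda>k::nat. real (Suc k) powr (- \<sigma>)) summable_on UNIV"
proof -
  have "summable (\<lambda>k::nat. real (Suc k) powr (- \<sigma>))"
    using assms summable_real_powr_iff[of "- \<sigma>"] summable_Suc_iff[of "\<lambda>n. real n powr (- \<sigma>)"] by simp
  then show ?thesis by (simp add: summable_on_UNIV_nonneg_real_iff)
qed

text \<open>The analytic continuation to \<open>Re w > 0\<close> of \<open>w - 1\<close> times the sum of \<open>f\<^sup>-\<^sup>w\<close> over
  \<open>f \<in> {j, j + N, j + 2 N, \<dots>}\<close>. It compares each term with the integral of \<open>x\<^sup>-\<^sup>w\<close> over the following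
  interval of length \<open>N\<close>; clearing the denominator \<open>w - 1\<close> of these integrals avoids
  removable singularities.\<close>

definition progression_zeta_numerator :: "nat \<Rightarrow> nat \<Rightarrow> complex \<Rightarrow> complex" where
  "progression_zeta_numerator N j w = (of_nat j powr (1 - w)
     + (\<Sum>\<^sub>\<infinity>k. of_nat N * (w - 1) * of_nat (j + N * k) powr (- w)
           + of_nat (j + N * Suc k) powr (1 - w) - of_nat (j + N * k) powr (1 - w))) / of_nat N"

lemma holomorphic_progression_zeta_numerator:
  assumes "N > 0" "j > 0"
  shows "progression_zeta_numerator N j holomorphic_on {w. Re w > 0}"
proof -
  let ?t = "\<lambda>k w. of_nat N * (w - 1) * of_nat (j + N * k) powr (- w)
           + of_nat (j + N * Suc k) powr (1 - w) - (of_nat (j + N * k) powr (1 - w) :: complex)"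
  have "(\<lambda>w. \<Sum>\<^sub>\<infinity>k. ?t k w) holomorphic_on {w. Re w > 0}"
  proof (rule holomorphic_on_infsum)
    show "open {w. Re w > 0}" by (rule open_halfspace_Re_gt)
    show "?t k holomorphic_on {w. Re w > 0}" for k
      using assms by (auto intro!: holomorphic_intros simp: add_pos_nonneg simp del: of_nat_add of_nat_mult)
    fix z assume z: "z \<in> {w. Re w > 0}"
    define \<sigma> where "\<sigma> = Re z / 2"
    define r where "r = Re z / 2"
    define C where "C = (real N)\<^sup>2 * (norm z + r) * (norm z + r + 1)"
    have pos: "\<sigma> > 0" "r > 0" using z by (auto simp: \<sigma>_def r_def)
    have re: "\<sigma> \<le> Re w" if "w \<in> cball z r" for w
      using cball_half_plane[of 0 z w] z that by (simp add: \<sigma>_def r_def)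
    have "norm (?t k w) \<le> C * real (Suc k) powr (- (\<sigma> + 1))" if w: "w \<in> cball z r" for k w
    proof -
      define y where "y = real (j + N * k)"
      have "k \<le> N * k" using \<open>N > 0\<close> by simp
      then have "Suc k \<le> j + N * k" using \<open>j > 0\<close> by linarith
      then have y: "y \<ge> real (Suc k)" unfolding y_def of_nat_le_iff .
      have "norm (?t k w) = norm (of_real (real N) * (w - 1) * of_real y powr (- w)
          + of_real (y + real N) powr (1 - w) - of_real y powr (1 - w))"
        by (simp add: y_def algebra_simps)
      also have "\<dots> \<le> (real N)\<^sup>2 * norm w * norm (w - 1) * y powr (- Re w - 1)"
        by (rule powr_Taylor_remainder_bound) (use y re[OF w] pos assms in auto)
      also have "\<dots> \<le> C * real (Suc k) powr (- (\<sigma> + 1))"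
      proof (intro mult_mono)
        have nw: "norm w \<le> norm z + r"
          using w norm_triangle_ineq2[of w z] by (simp add: dist_norm norm_minus_commute)
        have "norm (w - 1) \<le> norm w + 1" using norm_triangle_ineq4[of w 1] by simp
        then show "(real N)\<^sup>2 * norm w * norm (w - 1) \<le> C"
          unfolding C_def using nw pos by (intro mult_mono) auto
        have "y powr (- Re w - 1) \<le> real (Suc k) powr (- Re w - 1)"
          using y re[OF w] pos by (intro powr_mono2') auto
        also have "\<dots> \<le> real (Suc k) powr (- (\<sigma> + 1))"
          using re[OF w] by (intro powr_mono) auto
        finally show "y powr (- Re w - 1) \<le> real (Suc k) powr (- (\<sigma> + 1))" .
        show "0 \<le> C" using pos by (simp add: C_def)
      qed simp
      finally show ?thesis .
    qed
    moreover have "(\<lambda>k. C * real (Suc k) powr (- (\<sigma> + 1))) summable_on UNIV"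
      using pos by (intro summable_on_cmult_right summable_on_powr_shift) simp
    moreover have "cball z r \<subseteq> {w. Re w > 0}" using re pos by fastforce
    ultimately show "\<exists>r>0. \<exists>M. cball z r \<subseteq> {w. Re w > 0} \<and> M summable_on UNIV \<and>
        (\<forall>k\<in>UNIV. \<forall>w\<in>cball z r. norm (?t k w) \<le> M k)"
      using pos by blast
  qed
  then show ?thesis unfolding progression_zeta_numerator_def
    using assms by (auto intro!: holomorphic_intros)
qed

text \<open>For \<open>Re w > 1\<close> the differences of powers in the numerator telescope to \<open>- j\<^sup>1\<^sup>-\<^sup>w\<close>, and
  cancel the leading term.\<close>

lemma has_sum_progression_zeta:
  assumes "N > 0" "j > 0" and w: "Re w > 1"
  shows "((\<lambda>k. of_nat (j + N * k) powr (- w)) has_sum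
           (progression_zeta_numerator N j w / (w - 1))) UNIV"
proof -
  have le: "Suc k \<le> j + N * k" for k
  proof -
    have "k \<le> N * k" using \<open>N > 0\<close> by simp
    then show ?thesis using \<open>j > 0\<close> by linarith
  qed
  have bd: "norm (of_nat (j + N * k) powr (- w)) \<le> real (Suc k) powr (- Re w)" for k
  proof -
    have "norm (of_nat (j + N * k) powr (- w)) = real (j + N * k) powr (- Re w)"
      using norm_powr_real_powr[of "of_nat (j + N * k)" "- w"] by simp
    also have "\<dots> \<le> real (Suc k) powr (- Re w)"
      using le w by (intro powr_mono2') (auto simp del: of_nat_add of_nat_mult of_nat_Suc)
    finally show ?thesis .
  qed
  have sm: "(\<lambda>k. of_nat (j + N * k) powr (- w)) summable_on UNIV"
    by (rule abs_summable_summable, rule Infinite_Sum.abs_summable_on_comparison_test'[OF summable_on_powr_shift[OF w]])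
      (rule bd)
  then obtain Z where Z: "((\<lambda>k. of_nat (j + N * k) powr (- w)) has_sum Z) UNIV"
    by (auto simp: summable_on_def)
  let ?a = "\<lambda>k. of_nat (j + N * k) powr (1 - w) :: complex"
  have "?a \<longlonglongrightarrow> 0"
  proof (rule Lim_null_comparison)
    have "(\<lambda>k. real (Suc k) powr (1 - Re w)) \<longlonglongrightarrow> 0"
      using w tendsto_neg_powr[of "1 - Re w" "\<lambda>k. real (Suc k)" sequentially]
        filterlim_compose[OF filterlim_real_sequentially filterlim_Suc] by simp
    then show "(\<lambda>k. real (Suc k) powr (1 - Re w)) \<longlonglongrightarrow> 0" .
    show "\<forall>\<^sub>F k in sequentially. norm (?a k) \<le> real (Suc k) powr (1 - Re w)"
    proof (intro always_eventually allI)
      fix k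
      have "norm (?a k) = real (j + N * k) powr (1 - Re w)"
        using norm_powr_real_powr[of "of_nat (j + N * k)" "1 - w"] by simp
      also have "\<dots> \<le> real (Suc k) powr (1 - Re w)"
        using le w by (intro powr_mono2') (auto simp del: of_nat_add of_nat_mult of_nat_Suc)
      finally show "norm (?a k) \<le> real (Suc k) powr (1 - Re w)" .
    qed
  qed
  then have "(\<lambda>k. ?a (Suc k) - ?a k) sums (0 - ?a 0)" by (rule telescope_sums)
  moreover have "(\<lambda>k. of_nat (j + N * k) powr (- w)) sums Z" using Z by (rule has_sum_imp_sums)
  then have "(\<lambda>k. of_nat N * (w - 1) * of_nat (j + N * k) powr (- w)) sums (of_nat N * (w - 1) * Z)"
    by (rule sums_mult)
  ultimately have sums: "(\<lambda>k. of_nat N * (w - 1) * of_nat (j + N * k) powr (- w) + (?a (Suc k) - ?a k))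
      sums (of_nat N * (w - 1) * Z + (0 - ?a 0))"
    by (intro sums_add)
  have "(\<lambda>k. norm (of_nat N * (w - 1) * of_nat (j + N * k) powr (- w) + (?a (Suc k) - ?a k))) summable_on UNIV"
  proof (rule Infinite_Sum.abs_summable_on_comparison_test')
    show "(\<lambda>k. (real N)\<^sup>2 * norm w * norm (w - 1) * real (Suc k) powr (- (Re w + 1))) summable_on UNIV"
      using w by (intro summable_on_cmult_right summable_on_powr_shift) simp
    fix k
    define y where "y = real (j + N * k)"
    have y: "y \<ge> real (Suc k)" unfolding y_def using le by (simp only: of_nat_le_iff)
    have "norm (of_nat N * (w - 1) * of_nat (j + N * k) powr (- w) + (?a (Suc k) - ?a k))
        = norm (of_real (real N) * (w - 1) * of_real y powr (- w)
          + of_real (y + real N) powr (1 - w) - of_real y powr (1 - w))"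
      by (simp add: y_def algebra_simps)
    also have "\<dots> \<le> (real N)\<^sup>2 * norm w * norm (w - 1) * y powr (- Re w - 1)"
      by (rule powr_Taylor_remainder_bound) (use y w assms in auto)
    also have "\<dots> \<le> (real N)\<^sup>2 * norm w * norm (w - 1) * real (Suc k) powr (- (Re w + 1))"
    proof (intro mult_left_mono)
      have "- (Re w + 1) = - Re w - 1" by simp
      then show "y powr (- Re w - 1) \<le> real (Suc k) powr (- (Re w + 1))"
        using y w powr_mono2'[of "- Re w - 1" "real (Suc k)" y] by simp
    qed simp
    finally show "norm (of_nat N * (w - 1) * of_nat (j + N * k) powr (- w) + (?a (Suc k) - ?a k))
        \<le> (real N)\<^sup>2 * norm w * norm (w - 1) * real (Suc k) powr (- (Re w + 1))" .
  qed
  then have "(\<lambda>k. of_nat N * (w - 1) * of_nat (j + N * k) powr (- w) + (?a (Suc k) - ?a k)) summable_on UNIV"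
    by (rule abs_summable_summable)
  then have "(\<Sum>\<^sub>\<infinity>k. of_nat N * (w - 1) * of_nat (j + N * k) powr (- w) + (?a (Suc k) - ?a k))
      = of_nat N * (w - 1) * Z + (0 - ?a 0)"
    by (rule sums_unique2[OF has_sum_imp_sums[OF has_sum_infsum] sums])
  then have "progression_zeta_numerator N j w = (w - 1) * Z"
    unfolding progression_zeta_numerator_def using \<open>N > 0\<close> by (simp add: add_diff_eq)
  moreover have "w \<noteq> 1" using w by auto
  ultimately show ?thesis using Z by simp
qed

section \<open>Dirichlet convolutions with periodic bounded weights\<close>

lemma summable_on_times_product:
  fixes u :: "'a \<Rightarrow> real" and v :: "'b \<Rightarrow> real"
  assumes "u summable_on A" "v summable_on B" "\<And>x. x \<in> A \<Longrightarrow> u x \<ge> 0" "\<And>y. y \<in> B \<Longrightarrow> v y \<ge> 0"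
  shows "(\<lambda>(x, y). u x * v y) summable_on A \<times> B"
proof (rule summable_on_SigmaI)
  show "((\<lambda>y. case (x, y) of (x, y) \<Rightarrow> u x * v y) has_sum u x * infsum v B) B" for x
    using assms(2) by (simp add: has_sum_cmult_right)
  show "(\<lambda>x. u x * infsum v B) summable_on A" using assms(1) by (rule summable_on_cmult_left)
qed (use assms in auto)

lemma summable_on_powr_ge_1:
  assumes "\<sigma> > 1"
  shows "(\<lambda>n::nat. real n powr (- \<sigma>)) summable_on {1..}"
proof -
  have "bij_betw Suc UNIV {1..}"
    by (rule bij_betwI[where g = "\<lambda>n. n - 1"]) auto
  then have "(\<lambda>n::nat. real n powr (- \<sigma>)) summable_on {1..} \<longleftrightarrow>
      (\<lambda>n::nat. real (Suc n) powr (- \<sigma>)) summable_on UNIV"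
    using summable_on_reindex_bij_betw[of Suc UNIV "{1..}" "\<lambda>n. real n powr (- \<sigma>)"] by simp
  then show ?thesis using summable_on_powr_shift[OF assms] by blast
qed

lemma of_nat_mult_powr:
  "(of_nat (m * n) :: complex) powr s = of_nat m powr s * of_nat n powr s"
  using powr_times_real[of "of_nat m" "of_nat n" s] by simp

lemma bij_betw_residue_class_nat:
  assumes "N > 0"
  shows "bij_betw (\<lambda>(j, k). j + N * k) ({1..N} \<times> UNIV) {1::nat..}"
proof (rule bij_betwI[where g = "\<lambda>f. ((f - 1) mod N + 1, (f - 1) div N)"])
  show "(\<lambda>f. ((f - 1) mod N + 1, (f - 1) div N)) \<in> {1..} \<rightarrow> {1..N} \<times> UNIV"
    using assms by (auto simp: Suc_le_eq)
  fix p assume p: "p \<in> {1..N} \<times> (UNIV :: nat set)"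
  then obtain j k where jk: "p = (j, k)" "1 \<le> j" "j \<le> N" by auto
  then show "(\<lambda>f. ((f - 1) mod N + 1, (f - 1) div N)) ((\<lambda>(j, k). j + N * k) p) = p"
    using assms by (cases j) simp_all
next
  fix f :: nat assume "f \<in> {1..}"
  then show "(\<lambda>(j, k). j + N * k) ((f - 1) mod N + 1, (f - 1) div N) = f"
    using mod_mult_div_eq[of "f - 1" N] by simp
qed auto

lemma bij_betw_factor_triples:
  "bij_betw (\<lambda>((D, e), f). (D * e * f, (D, e))) (({1..} \<times> {1..}) \<times> {1..})
     (SIGMA n:{1::nat..}. {(D, e). D * e dvd n})"
proof (rule bij_betwI[where g = "\<lambda>(n, (D, e)). ((D, e), n div (D * e))"])
  show "(\<lambda>(n, (D, e)). ((D, e), n div (D * e)))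
      \<in> (SIGMA n:{1::nat..}. {(D, e). D * e dvd n}) \<rightarrow> ({1..} \<times> {1..}) \<times> {1..}"
  proof
    fix z assume "z \<in> (SIGMA n:{1::nat..}. {(D, e). D * e dvd n})"
    then obtain n D e where z: "z = (n, (D, e))" "n > 0" "D * e dvd n" by auto
    then obtain f where "n = D * e * f" by blast
    then show "(\<lambda>(n, (D, e)). ((D, e), n div (D * e))) z \<in> ({1..} \<times> {1..}) \<times> {1..}"
      using z by (auto simp: Suc_le_eq)
  qed
qed (auto simp: Suc_le_eq)

text \<open>For \<open>Re s > 2\<close> the triple sum of \<open>h(D, e, f) f (D e f)\<^sup>-\<^sup>s\<close> converges absolutely. Grouping
  it by the product \<open>n = D e f\<close> gives the left-hand side; grouping it by the residue \<open>j\<close> of \<open>f\<close>, on which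
  alone \<open>h(D, e, f)\<close> depends, makes the sums over \<open>(D, e)\<close> and over \<open>f\<close> separate.\<close>

lemma has_sum_dirichlet_convolution:
  fixes h :: "nat \<Rightarrow> nat \<Rightarrow> nat \<Rightarrow> complex"
  assumes N: "N > 0" and bd: "\<And>D e f. norm (h D e f) \<le> 1"
    and per: "\<And>D e f. h D e (f + N) = h D e f" and s: "Re s > 2"
  shows "((\<lambda>n. (\<Sum>(D, e) | D * e dvd n. h D e (n div (D * e)) * of_nat (n div (D * e)))
             * of_nat n powr (- s)) has_sum
     ((\<Sum>j=1..N. (\<Sum>\<^sub>\<infinity>(D, e)\<in>{1..} \<times> {1..}. h D e j * of_real (real (D * e)) powr (- s))
             * progression_zeta_numerator N j (s - 1)) / (s - 2))) {1..}"
proof -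
  define P where "P = {1::nat..}"
  define H where "H = (\<lambda>j. \<Sum>\<^sub>\<infinity>(D, e)\<in>P \<times> P. h D e j * of_real (real (D * e)) powr (- s))"
  define t where "t = (\<lambda>((D, e), f). h D e f * of_nat f * of_nat (D * e * f) powr (- s))"
  define \<sigma> where "\<sigma> = Re s"
  have nrm: "norm ((of_nat n :: complex) powr z) = real n powr Re z" for n z
    using norm_powr_real_powr[of "of_nat n" z] by simp
  have pp: "(\<lambda>(D, e). real D powr (- \<sigma>) * real e powr (- \<sigma>)) summable_on P \<times> P"
    unfolding P_def using s by (intro summable_on_times_product summable_on_powr_ge_1) (auto simp: \<sigma>_def)
  have factor: "t ((D, e), f) = (h D e f * of_real (real (D * e)) powr (- s)) * of_nat f powr (- (s - 1))"
    if "f \<in> P" for D e f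
  proof -
    have "(of_nat f :: complex) powr (- (s - 1)) = of_nat f * of_nat f powr (- s)"
      using that powr_add[of "of_nat f" "1::complex" "- s"] by (simp add: P_def)
    then show ?thesis by (simp only: t_def prod.case of_nat_mult_powr of_real_of_nat_eq mult_ac)
  qed
  have t_summable: "(\<lambda>p. norm (t p)) summable_on (P \<times> P) \<times> P"
  proof (rule summable_on_comparison_test)
    show "(\<lambda>(p, f). (case p of (D, e) \<Rightarrow> real D powr (- \<sigma>) * real e powr (- \<sigma>)) * real f powr (- (\<sigma> - 1)))
        summable_on (P \<times> P) \<times> P"
      using pp s unfolding P_def
      by (intro summable_on_times_product summable_on_powr_ge_1) (auto simp: \<sigma>_def)
    fix q assume "q \<in> (P \<times> P) \<times> P"
    then obtain D e f where q: "q = ((D, e), f)" "f \<in> P" by auto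
    have "norm (t q) = norm (h D e f) * (real D powr (- \<sigma>) * real e powr (- \<sigma>)) * real f powr (- (\<sigma> - 1))"
      unfolding q(1) factor[OF q(2)] of_real_of_nat_eq norm_mult nrm
      by (simp add: \<sigma>_def powr_mult)
    also have "\<dots> \<le> 1 * (real D powr (- \<sigma>) * real e powr (- \<sigma>)) * real f powr (- (\<sigma> - 1))"
      by (intro mult_right_mono bd) auto
    finally show "norm (t q) \<le> (case q of (p, f) \<Rightarrow>
        (case p of (D, e) \<Rightarrow> real D powr (- \<sigma>) * real e powr (- \<sigma>)) * real f powr (- (\<sigma> - 1)))"
      by (simp add: q)
  qed simp
  then obtain T where T: "(t has_sum T) ((P \<times> P) \<times> P)"
    using abs_summable_summable summable_on_def by blast

  have H: "((\<lambda>(D, e). h D e j * of_real (real (D * e)) powr (- s)) has_sum H j) (P \<times> P)" for j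
  proof -
    have "(\<lambda>p. norm (case p of (D, e) \<Rightarrow> h D e j * of_real (real (D * e)) powr (- s))) summable_on P \<times> P"
    proof (rule summable_on_comparison_test[OF pp])
      fix p assume "p \<in> P \<times> P"
      obtain D e where p: "p = (D, e)" by (cases p)
      have "norm (h D e j * of_real (real (D * e)) powr (- s))
          \<le> 1 * (real D powr (- \<sigma>) * real e powr (- \<sigma>))"
        unfolding of_real_of_nat_eq norm_mult nrm
        using bd[of D e j] by (intro mult_mono) (auto simp: \<sigma>_def powr_mult)
      then show "norm (case p of (D, e) \<Rightarrow> h D e j * of_real (real (D * e)) powr (- s))
          \<le> (case p of (D, e) \<Rightarrow> real D powr (- \<sigma>) * real e powr (- \<sigma>))" by (simp add: p)
    qed simp
    then show ?thesis unfolding H_def using abs_summable_summable has_sum_infsum by blast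
  qed

  \<comment> \<open>Summation over \<open>(D, e)\<close> first, then over the residue classes of \<open>f\<close>.\<close>
  have "((\<lambda>f. H f * of_nat f powr (- (s - 1))) has_sum T) P"
  proof (rule has_sum_SigmaD)
    show "((\<lambda>(f, p). t (p, f)) has_sum T) (P \<times> (P \<times> P))" using T has_sum_swap by blast
    fix f assume f: "f \<in> P"
    have "((\<lambda>p. (case p of (D, e) \<Rightarrow> h D e f * of_real (real (D * e)) powr (- s))
            * of_nat f powr (- (s - 1))) has_sum H f * of_nat f powr (- (s - 1))) (P \<times> P)"
      by (rule has_sum_cmult_left[OF H])
    then show "((\<lambda>p. case (f, p) of (f, p) \<Rightarrow> t (p, f)) has_sum H f * of_nat f powr (- (s - 1))) (P \<times> P)"
      by (rule has_sum_cong[THEN iffD1, rotated]) (auto simp: factor[OF f])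
  qed
  then have "((\<lambda>(j, k). H (j + N * k) * of_nat (j + N * k) powr (- (s - 1))) has_sum T) ({1..N} \<times> UNIV)"
    using has_sum_reindex_bij_betw[OF bij_betw_residue_class_nat[OF N],
        of "\<lambda>f. H f * of_nat f powr (- (s - 1))" T]
    by (simp add: P_def case_prod_unfold)
  moreover have "H (j + N * k) = H j" for j k
  proof -
    have "h D e (j + N * k) = h D e j" for D e
    proof (induction k)
      case (Suc k)
      then show ?case using per[of D e "j + N * k"] by (simp add: algebra_simps)
    qed simp
    then show ?thesis by (simp add: H_def)
  qed
  ultimately have T2: "((\<lambda>(j, k). H j * of_nat (j + N * k) powr (- (s - 1))) has_sum T) ({1..N} \<times> UNIV)"
    by simp
  have "((\<lambda>j. H j * (progression_zeta_numerator N j (s - 1) / (s - 1 - 1))) has_sum T) {1..N}"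
  proof (rule has_sum_SigmaD[OF T2])
    fix j assume "j \<in> {1..N}"
    then have "((\<lambda>k. of_nat (j + N * k) powr (- (s - 1))) has_sum
        (progression_zeta_numerator N j (s - 1) / (s - 1 - 1))) UNIV"
      using N s by (intro has_sum_progression_zeta) auto
    then show "((\<lambda>k. case (j, k) of (j, k) \<Rightarrow> H j * of_nat (j + N * k) powr (- (s - 1))) has_sum
        H j * (progression_zeta_numerator N j (s - 1) / (s - 1 - 1))) UNIV"
      unfolding prod.case by (rule has_sum_cmult_right)
  qed
  then have "T = (\<Sum>j=1..N. H j * (progression_zeta_numerator N j (s - 1) / (s - 1 - 1)))"
    using has_sum_finite has_sum_unique by blast
  then have T_eq: "T = (\<Sum>j=1..N. H j * progression_zeta_numerator N j (s - 1)) / (s - 2)"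
    by (simp add: sum_divide_distrib)

  \<comment> \<open>The same total, grouped by \<open>n = D e f\<close>.\<close>
  let ?u = "\<lambda>(n, (D, e)). h D e (n div (D * e)) * of_nat (n div (D * e)) * (of_nat n :: complex) powr (- s)"
  have "((\<lambda>q. ?u ((\<lambda>((D, e), f). (D * e * f, (D, e))) q)) has_sum T) ((P \<times> P) \<times> P)"
    by (rule has_sum_cong[THEN iffD1, OF _ T]) (auto simp: t_def P_def)
  then have u: "(?u has_sum T) (SIGMA n:P. {(D, e). D * e dvd n})"
    using has_sum_reindex_bij_betw[OF bij_betw_factor_triples, of ?u T] by (simp add: P_def)
  have "((\<lambda>n. (\<Sum>(D, e) | D * e dvd n. h D e (n div (D * e)) * of_nat (n div (D * e)))
             * of_nat n powr (- s)) has_sum T) P"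
  proof (rule has_sum_SigmaD[OF u])
    fix n assume n: "n \<in> P"
    have "{(D, e). D * e dvd n} \<subseteq> {..n} \<times> {..n}"
    proof
      fix z assume "z \<in> {(D, e). D * e dvd n}"
      then obtain D e where z: "z = (D, e)" "D * e dvd n" by auto
      then have "D dvd n" "e dvd n" by (metis dvd_mult_left, metis dvd_mult_right)
      then show "z \<in> {..n} \<times> {..n}" using n z(1) by (auto simp: P_def intro!: dvd_imp_le)
    qed
    then have fin: "finite {(D, e). D * e dvd n}" by (rule finite_subset) simp
    show "((\<lambda>p. ?u (n, p)) has_sum (\<Sum>(D, e) | D * e dvd n.
        h D e (n div (D * e)) * of_nat (n div (D * e))) * of_nat n powr (- s)) {(D, e). D * e dvd n}"
      by (rule has_sum_finiteI[OF fin]) (simp add: sum_distrib_right case_prod_unfold)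
  qed
  then show ?thesis by (simp add: T_eq H_def P_def)
qed

lemma holomorphic_dirichlet_convolution:
  fixes h :: "nat \<Rightarrow> nat \<Rightarrow> nat \<Rightarrow> complex"
  assumes N: "N > 0" and bd: "\<And>D e f. norm (h D e f) \<le> 1"
  shows "(\<lambda>s. \<Sum>j=1..N. (\<Sum>\<^sub>\<infinity>(D, e)\<in>{1..} \<times> {1..}. h D e j * of_real (real (D * e)) powr (- s))
             * progression_zeta_numerator N j (s - 1)) holomorphic_on {s. Re s > 1}"
proof (intro holomorphic_on_sum holomorphic_on_mult)
  fix j assume j: "j \<in> {1..N}"
  have "(\<lambda>s. \<Sum>\<^sub>\<infinity>p\<in>{1..} \<times> {1..}. h (fst p) (snd p) j * of_real (real (fst p * snd p)) powr (- s))
      holomorphic_on {s. Re s > 1}"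
  proof (rule holomorphic_on_dirichlet_infsum)
    show "1 \<le> real (fst p * snd p)" if "p \<in> {1..} \<times> {1..}" for p :: "nat \<times> nat"
      using that by (auto simp: Suc_le_eq simp flip: of_nat_mult)
    fix \<sigma> :: real assume \<sigma>: "\<sigma> > 1"
    show "(\<lambda>p. norm (h (fst p) (snd p) j) * real (fst p * snd p) powr (- \<sigma>)) summable_on {1..} \<times> {1..}"
    proof (rule summable_on_comparison_test)
      show "(\<lambda>(D, e). real D powr (- \<sigma>) * real e powr (- \<sigma>)) summable_on {1..} \<times> {1..}"
        using \<sigma> by (intro summable_on_times_product summable_on_powr_ge_1) auto
      fix p :: "nat \<times> nat"
      have "norm (h (fst p) (snd p) j) * real (fst p * snd p) powr (- \<sigma>)
          \<le> 1 * real (fst p * snd p) powr (- \<sigma>)"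
        by (intro mult_right_mono bd) simp
      then show "norm (h (fst p) (snd p) j) * real (fst p * snd p) powr (- \<sigma>)
          \<le> (case p of (D, e) \<Rightarrow> real D powr (- \<sigma>) * real e powr (- \<sigma>))"
        by (simp add: case_prod_unfold powr_mult)
    qed simp
  qed
  then show "(\<lambda>s. \<Sum>\<^sub>\<infinity>(D, e)\<in>{1..} \<times> {1..}. h D e j * of_real (real (D * e)) powr (- s))
      holomorphic_on {s. Re s > 1}"
    by (simp add: case_prod_unfold)
  have "progression_zeta_numerator N j \<circ> (\<lambda>s. s - 1) holomorphic_on {s. Re s > 1}"
    using N j by (intro holomorphic_on_compose_gen[OF _ holomorphic_progression_zeta_numerator])
      (auto intro!: holomorphic_intros)
  then show "(\<lambda>s. progression_zeta_numerator N j (s - 1)) holomorphic_on {s. Re s > 1}"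
    by (simp add: o_def)
qed

section \<open>Dirichlet series with coefficients of linear growth\<close>

lemma powr_first_difference_bound:
  assumes y: "y > 0" and w: "Re w > 0"
  shows "norm (of_real (y + 1) powr (- w) - of_real y powr (- w)) \<le> norm w * y powr (- Re w - 1)"
proof -
  define S where "S = closed_segment (of_real y :: complex) (of_real (y + 1))"
  have S: "\<exists>x\<ge>y. z = of_real x" if z: "z \<in> S" for z
  proof -
    obtain u where u: "0 \<le> u" "u \<le> 1"
      "z = (1 - u) *\<^sub>R complex_of_real y + u *\<^sub>R complex_of_real (y + 1)"
      using z unfolding S_def in_segment by blast
    then have "z = of_real (y + u)" by (simp add: scaleR_conv_of_real algebra_simps)
    then show ?thesis using u(1) by (intro exI[of _ "y + u"]) simp
  qed
  have "norm (of_real (y + 1) powr (- w) - of_real y powr (- w))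
      \<le> norm w * y powr (- Re w - 1) * norm (of_real (y + 1) - (of_real y :: complex))"
  proof (rule field_differentiable_bound)
    show "convex S" by (simp add: S_def)
    show "of_real (y + 1) \<in> S" "of_real y \<in> S" by (simp_all add: S_def)
    fix z assume z: "z \<in> S"
    then obtain x where x: "x \<ge> y" "z = of_real x" using S by blast
    have "z \<notin> \<real>\<^sub>\<le>\<^sub>0" using x y by (auto simp: complex_nonpos_Reals_iff)
    then show "((\<lambda>z. z powr (- w)) has_field_derivative (- w) * z powr (- w - 1)) (at z within S)"
      using has_field_derivative_at_within has_field_derivative_powr by blast
    have "x powr (- Re w - 1) \<le> y powr (- Re w - 1)"
      using x y w by (intro powr_mono2') auto
    then show "norm ((- w) * z powr (- w - 1)) \<le> norm w * y powr (- Re w - 1)"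
      using x y by (simp add: norm_mult norm_powr_real_powr mult_left_mono)
  qed
  then show ?thesis by simp
qed

lemma summation_by_parts:
  fixes b v :: "nat \<Rightarrow> 'a :: comm_ring_1"
  shows "(\<Sum>i<n. b i * v i) = (\<Sum>i<n. b i) * v n - (\<Sum>i<n. (\<Sum>k<Suc i. b k) * (v (Suc i) - v i))"
  by (induction n) (simp_all add: algebra_simps)

text \<open>Abel summation: the partial sums at \<open>s\<close> are bounded, and the factors \<open>n\<^sup>-\<^sup>w\<close> with \<open>w = s' - s\<close>
  tend to zero and are of bounded variation. Absolute convergence at \<open>s\<close> is not available here, since the
  abscissa is defined through conditional convergence.\<close>

lemma summable_dirichlet_term_mono:
  assumes sm: "summable (dirichlet_term a s)" and re: "Re s < Re s'"
  shows "summable (dirichlet_term a s')"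
proof -
  define w where "w = s' - s"
  have w: "Re w > 0" using re by (simp add: w_def)
  let ?b = "dirichlet_term a s"
  let ?v = "\<lambda>n. (of_nat (Suc n) :: complex) powr (- w)"
  have nv: "norm (?v n) = real (Suc n) powr (- Re w)" for n
    using norm_powr_real_powr[of "of_nat (Suc n)" "- w"] by simp
  have prod: "dirichlet_term a s' n = ?b n * ?v n" for n
  proof -
    have "- s' = - s + - w" by (simp add: w_def)
    then show ?thesis unfolding dirichlet_term_def by (simp only: powr_add mult.assoc)
  qed
  have conv: "convergent (\<lambda>n. \<Sum>i<n. ?b i)" using sm summable_iff_convergent by blast
  then obtain M where M: "\<And>n. norm (\<Sum>i<n. ?b i) \<le> M" 
    using convergent_imp_Bseq Bseq_def by metis
  have "(\<lambda>n. norm (?v n)) \<longlonglongrightarrow> 0"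
    unfolding nv using w tendsto_neg_powr[of "- Re w" "\<lambda>n. real (Suc n)" sequentially]
      filterlim_compose[OF filterlim_real_sequentially filterlim_Suc] by simp
  then have v0: "?v \<longlonglongrightarrow> 0" by (rule tendsto_norm_zero_cancel)
  have "convergent (\<lambda>n. (\<Sum>i<n. ?b i) * ?v n)"
    using conv v0 by (intro convergent_mult) (auto simp: convergent_def)
  moreover have "summable (\<lambda>i. (\<Sum>k<Suc i. ?b k) * (?v (Suc i) - ?v i))"
  proof (rule summable_comparison_test')
    have "summable (\<lambda>i::nat. real (Suc i) powr (- (Re w + 1)))"
      using w by (intro summable_on_imp_summable summable_on_powr_shift) simp
    then show "summable (\<lambda>i. M * (norm w * real (Suc i) powr (- (Re w + 1))))"
      by (intro summable_mult)
    fix i :: nat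
    have "norm (?v (Suc i) - ?v i) \<le> norm w * real (Suc i) powr (- (Re w + 1))"
      using powr_first_difference_bound[of "real (Suc i)" w] w
      unfolding minus_add_distrib diff_conv_add_uminus[symmetric] by (simp add: add_ac)
    then show "norm ((\<Sum>k<Suc i. ?b k) * (?v (Suc i) - ?v i))
        \<le> M * (norm w * real (Suc i) powr (- (Re w + 1)))"
      unfolding norm_mult using order_trans[OF norm_ge_zero M] by (intro mult_mono M) auto
  qed
  then have "convergent (\<lambda>n. \<Sum>i<n. (\<Sum>k<Suc i. ?b k) * (?v (Suc i) - ?v i))"
    using summable_iff_convergent by blast
  ultimately have "convergent (\<lambda>n. \<Sum>i<n. ?b i * ?v i)"
    unfolding summation_by_parts[of ?b ?v] by (rule convergent_diff)
  then show ?thesis by (simp add: summable_iff_convergent prod)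
qed

lemma dirichlet_term_of_real:
  "dirichlet_term (\<lambda>n. of_nat (a n)) (of_real \<sigma>) n
    = of_real (real (a (Suc n)) * real (Suc n) powr (- \<sigma>))"
  unfolding dirichlet_term_def
  using powr_of_real[of "real (Suc n)" "- \<sigma>"] by simp

text \<open>The upper bound gives convergence for \<open>Re s > 2\<close>, and the lower bound gives divergence at
  \<open>s = 2\<close> by comparison with the harmonic series. Divergence at \<open>2\<close> excludes convergence further left,
  and it also excludes \<open>W 2 = 0\<close>.\<close>

theorem simple_pole_of_linear_growth:
  fixes a :: "nat \<Rightarrow> nat"
  assumes lower: "\<And>m. m > 0 \<Longrightarrow> m \<le> a m" and upper: "\<And>m. m > 0 \<Longrightarrow> a m \<le> C * m"
    and hol: "W holomorphic_on {s. Re s > 1}"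
    and eq: "\<And>s. Re s > 2 \<Longrightarrow> dirichlet_series (\<lambda>n. of_nat (a n)) s = W s / (s - 2)"
  shows "abscissa_of_convergence (\<lambda>n. of_nat (a n)) = 2"
    and "(\<lambda>s. W s / (s - 2)) meromorphic_on {s. Re s > 1}"
    and "is_pole (\<lambda>s. W s / (s - 2)) 2"
    and "zorder (\<lambda>s. W s / (s - 2)) 2 = - 1"
proof -
  let ?t = "dirichlet_term (\<lambda>n. of_nat (a n))"
  have conv: "summable (?t s)" if s: "Re s > 2" for s
  proof (rule summable_comparison_test')
    show "summable (\<lambda>n. real C * real (Suc n) powr (- (Re s - 1)))"
      using s by (intro summable_mult summable_on_imp_summable summable_on_powr_shift) simp
    fix n :: nat
    have nrm: "norm ((of_nat (Suc n) :: complex) powr (- s)) = real (Suc n) powr (- Re s)"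
      using norm_powr_real_powr[of "of_nat (Suc n)" "- s"] by simp
    have "norm (?t s n) = real (a (Suc n)) * real (Suc n) powr (- Re s)"
      unfolding dirichlet_term_def norm_mult nrm by simp
    also have "\<dots> \<le> real (C * Suc n) * real (Suc n) powr (- Re s)"
      using upper[of "Suc n"] by (intro mult_right_mono) (simp_all only: of_nat_le_iff zero_less_Suc powr_ge_zero)
    also have "\<dots> = real C * (real (Suc n) powr 1 * real (Suc n) powr (- Re s))"
      by (simp add: algebra_simps)
    also have "\<dots> = real C * real (Suc n) powr (- (Re s - 1))"
      unfolding powr_add[symmetric] by simp
    finally show "norm (?t s n) \<le> real C * real (Suc n) powr (- (Re s - 1))" .
  qed
  let ?r = "\<lambda>\<sigma> n. real (a (Suc n)) * real (Suc n) powr (- \<sigma>)"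
  have div: "\<not> summable (?r 2)"
  proof
    assume "summable (?r 2)"
    moreover have "norm (inverse (real (Suc n))) \<le> ?r 2 n" for n
    proof -
      have "inverse (real (Suc n)) = real (Suc n) * real (Suc n) powr (- 2)"
        using powr_add[of "real (Suc n)" 1 "- 2"]
        by (simp add: powr_neg_one inverse_eq_divide del: of_nat_Suc)
      also have "\<dots> \<le> ?r 2 n"
        using lower[of "Suc n"] by (intro mult_right_mono) (simp_all only: of_nat_le_iff zero_less_Suc powr_ge_zero)
      finally show ?thesis by simp
    qed
    ultimately have "summable (\<lambda>n. inverse (real (Suc n)))"
      by (rule summable_comparison_test')
    then show False using not_summable_harmonic[where 'a = real]
      by (subst (asm) summable_Suc_iff) simp
  qed
  have div': "\<not> summable (?t 2)"
  proof -
    have "?t (of_real 2) = (\<lambda>n. of_real (?r 2 n))"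
      by (rule ext) (rule dirichlet_term_of_real)
    then have "summable (?t (of_real 2)) \<longleftrightarrow> summable (?r 2)"
      by (simp only: summable_of_real_iff)
    then show ?thesis using div by simp
  qed

  show "abscissa_of_convergence (\<lambda>n. of_nat (a n)) = 2"
  proof (rule antisym)
    show "abscissa_of_convergence (\<lambda>n. of_nat (a n)) \<le> 2"
    proof (rule ereal_le_epsilon2)
      fix \<epsilon> :: real assume "\<epsilon> > 0"
      then have "summable (?t (of_real (2 + \<epsilon>)))" by (intro conv) simp
      then have "abscissa_of_convergence (\<lambda>n. of_nat (a n)) \<le> ereal (Re (of_real (2 + \<epsilon>)))"
        unfolding abscissa_of_convergence_def by (intro INF_lower) simp
      then show "abscissa_of_convergence (\<lambda>n. of_nat (a n)) \<le> 2 + ereal \<epsilon>" by simp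
    qed
    show "2 \<le> abscissa_of_convergence (\<lambda>n. of_nat (a n))"
      unfolding abscissa_of_convergence_def
    proof (rule INF_greatest)
      fix s assume "s \<in> {s. summable (?t s)}"
      then have "\<not> Re s < Re 2" using summable_dirichlet_term_mono div' by blast
      then show "2 \<le> ereal (Re s)" by simp
    qed
  qed

  \<comment> \<open>If \<open>W 2 = 0\<close>, then \<open>W s / (s - 2)\<close> tends to the derivative of \<open>W\<close> at \<open>2\<close>, which would
    bound all partial sums of the divergent series at \<open>2\<close>.\<close>
  have W2: "W 2 \<noteq> 0"
  proof
    assume "W 2 = 0"
    have "open {s. Re s > 1}" by (rule open_halfspace_Re_gt)
    then obtain D where "(W has_field_derivative D) (at 2)"
      using hol unfolding holomorphic_on_open[OF \<open>open {s. Re s > 1}\<close>] by fastforce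
    then have lim: "((\<lambda>s. W s / (s - 2)) \<longlongrightarrow> D) (at 2)"
      unfolding has_field_derivative_iff \<open>W 2 = 0\<close> by simp
    have "filterlim complex_of_real (at 2) (at_right 2)"
      unfolding filterlim_at
    proof
      have "complex_of_real x \<noteq> 2" if "x > 2" for x
        using that of_real_eq_iff[of x 2, where 'a = complex] by simp
      then show "\<forall>\<^sub>F x in at_right 2. complex_of_real x \<in> UNIV \<and> complex_of_real x \<noteq> 2"
        unfolding eventually_at_filter by (auto intro: always_eventually)
      show "(complex_of_real \<longlongrightarrow> 2) (at_right 2)"
        using tendsto_of_real[OF tendsto_ident_at[of "2::real" "{2<..}"], where 'a = complex] by simp
    qed
    from tendsto_Re[OF filterlim_compose[OF lim this]]
    have limR: "((\<lambda>\<sigma>. Re (W (of_real \<sigma>) / (of_real \<sigma> - 2))) \<longlongrightarrow> Re D) (at_right 2)" .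
    have "(\<Sum>n<M. ?r 2 n) \<le> Re D" for M
    proof (rule tendsto_le[OF _ limR])
      show "((\<lambda>\<sigma>. \<Sum>n<M. ?r \<sigma> n) \<longlongrightarrow> (\<Sum>n<M. ?r 2 n)) (at_right 2)"
        by (intro tendsto_intros) auto
      show "\<forall>\<^sub>F \<sigma> in at_right 2. (\<Sum>n<M. ?r \<sigma> n) \<le> Re (W (of_real \<sigma>) / (of_real \<sigma> - 2))"
        unfolding eventually_at_filter
      proof (intro always_eventually allI impI)
        fix \<sigma> :: real assume "\<sigma> \<in> {2<..}"
        then have \<sigma>: "Re (of_real \<sigma>) > 2" by simp
        have t: "?t (of_real \<sigma>) = (\<lambda>n. of_real (?r \<sigma> n))"
          by (rule ext) (rule dirichlet_term_of_real)
        have sm: "summable (?r \<sigma>)" using conv[OF \<sigma>] unfolding t summable_of_real_iff .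
        then have "dirichlet_series (\<lambda>n. of_nat (a n)) (of_real \<sigma>) = of_real (\<Sum>n. ?r \<sigma> n)"
          unfolding dirichlet_series_def t by (rule suminf_of_real[symmetric])
        then have "(\<Sum>n. ?r \<sigma> n) = Re (W (of_real \<sigma>) / (of_real \<sigma> - 2))"
          using eq[OF \<sigma>] by (metis Re_complex_of_real)
        moreover have "(\<Sum>n<M. ?r \<sigma> n) \<le> (\<Sum>n. ?r \<sigma> n)"
          by (rule sum_le_suminf[OF sm]) auto
        ultimately show "(\<Sum>n<M. ?r \<sigma> n) \<le> Re (W (of_real \<sigma>) / (of_real \<sigma> - 2))" by simp
      qed
    qed simp
    then have "summable (?r 2)" by (intro summableI_nonneg_bounded) auto
    then show False using div by contradiction
  qed
  have opn: "open {s. Re s > 1}" by (rule open_halfspace_Re_gt)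
  have in2: "2 \<in> {s. Re s > 1}" by simp
  have W: "W analytic_on {s. Re s > 1}" using hol opn by (simp add: analytic_on_open)
  show "(\<lambda>s. W s / (s - 2)) meromorphic_on {s. Re s > 1}"
    by (intro meromorphic_on_divide analytic_on_imp_meromorphic_on W analytic_intros)
  show z: "zorder (\<lambda>s. W s / (s - 2)) 2 = - 1"
    by (rule zorder_eqI[OF opn in2 hol W2]) (simp add: power_int_minus field_simps)
  show "is_pole (\<lambda>s. W s / (s - 2)) 2"
    using is_pole_basic[OF hol opn in2 W2, of 1] by simp
qed

section \<open>The zeta function of a sublattice of the hyperbolic plane\<close>

lemma card_admissible_residues:
  assumes "m > 0" "N > 0"
  shows "card (admissible_residues (int N) \<beta> m) =
    card {x. x < m * N \<and> fits N \<beta> (gcd x (m * N)) (m * N div gcd x (m * N)) (x div gcd x (m * N))}"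
proof -
  let ?S = "{x. x < m * N \<and> (\<exists>k>0. k dvd m \<and> [int x = \<beta> * (int k)\<^sup>2] (mod int (k * N)))}"
  have "admissible_residues (int N) \<beta> m = int ` ?S"
  proof (intro equalityI subsetI)
    fix x assume x: "x \<in> admissible_residues (int N) \<beta> m"
    then obtain k where k: "k > 0" "k dvd int m" "[x = \<beta> * k\<^sup>2] (mod k * int N)"
      and x': "0 \<le> x" "x < int m * int N"
      by (auto simp: admissible_residues_def)
    have "nat k > 0" "nat k dvd m" "[int (nat x) = \<beta> * (int (nat k))\<^sup>2] (mod int (nat k * N))"
      using k x' by (simp_all add: nat_dvd_iff)
    moreover have "nat x < m * N" using x' by (simp add: nat_less_iff)
    ultimately have "nat x \<in> ?S" by blast
    moreover have "x = int (nat x)" using x'(1) by simp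
    ultimately show "x \<in> int ` ?S" by (rule rev_image_eqI)
  next
    fix y assume "y \<in> int ` ?S"
    then obtain x k where y: "y = int x" and x: "x < m * N"
      and k: "k > 0" "k dvd m" "[int x = \<beta> * (int k)\<^sup>2] (mod int (k * N))" by blast
    have "0 < int k" "int k dvd int m" "[y = \<beta> * (int k)\<^sup>2] (mod int k * int N)"
      using k y by simp_all
    moreover have "y \<in> {0..<int m * int N}" using x y by (simp flip: of_nat_mult)
    ultimately show "y \<in> admissible_residues (int N) \<beta> m"
      unfolding admissible_residues_def by blast
  qed
  then have "card (admissible_residues (int N) \<beta> m) = card ?S" by (simp add: card_image)
  then show ?thesis unfolding fits_gcd_iff[OF assms] .
qed

text \<open>The lower bound comes from \<open>k = 1\<close> alone, which admits every \<open>x\<close> congruent to \<open>\<beta>\<close> modulo \<open>N\<close>.\<close>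

lemma card_admissible_residues_bounds:
  assumes "m > 0" "N > 0"
  shows "m \<le> card (admissible_residues N \<beta> m)" "card (admissible_residues N \<beta> m) \<le> nat N * m"
proof -
  have sub: "admissible_residues N \<beta> m \<subseteq> {0..<int m * N}" by (auto simp: admissible_residues_def)
  from card_mono[OF _ this] show "card (admissible_residues N \<beta> m) \<le> nat N * m"
    using assms by (simp add: nat_mult_distrib mult.commute)
  have "(\<lambda>i. \<beta> mod N + int i * N) ` {..<m} \<subseteq> admissible_residues N \<beta> m"
  proof
    fix x assume "x \<in> (\<lambda>i. \<beta> mod N + int i * N) ` {..<m}"
    then obtain i where i: "i < m" "x = \<beta> mod N + int i * N" by blast
    have "0 \<le> \<beta> mod N" "\<beta> mod N < N" using \<open>N > 0\<close> by simp_all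
    moreover have "int i * N + N \<le> int m * N"
      using i(1) \<open>N > 0\<close> mult_right_mono[of "int i + 1" "int m" N] by (simp add: algebra_simps)
    moreover have "0 \<le> int i * N" using \<open>N > 0\<close> by simp
    ultimately have "x \<in> {0..<int m * N}"
      unfolding i(2) atLeastLessThan_iff by linarith
    moreover have "[x = \<beta> * 1\<^sup>2] (mod 1 * N)" unfolding i(2) by (simp add: unique_euclidean_semiring_class.cong_def)
    moreover have "(0::int) < 1" "1 dvd int m" by simp_all
    ultimately show "x \<in> admissible_residues N \<beta> m" unfolding admissible_residues_def by blast
  qed
  then have "card ((\<lambda>i. \<beta> mod N + int i * N) ` {..<m}) \<le> card (admissible_residues N \<beta> m)"
    using finite_subset[OF sub] by (intro card_mono) auto
  moreover have "inj_on (\<lambda>i. \<beta> mod N + int i * N) {..<m}" using \<open>N > 0\<close> by (auto simp: inj_on_def)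
  ultimately show "m \<le> card (admissible_residues N \<beta> m)" by (simp add: card_image)
qed

text \<open>The Moebius sign times the proportion of indices \<open>i\<close> modulo \<open>N\<close> that are counted.\<close>

definition convolution_weight :: "nat \<Rightarrow> int \<Rightarrow> nat \<Rightarrow> nat \<Rightarrow> nat \<Rightarrow> complex" where
  "convolution_weight N \<beta> D e f = of_int (moebius_mu e) * of_nat (fit_count N \<beta> D e f) / of_nat N"

lemma norm_convolution_weight_le_1:
  assumes "N > 0"
  shows "norm (convolution_weight N \<beta> D e f) \<le> 1"
proof -
  have "real_of_int \<bar>moebius_mu e\<bar> * real (fit_count N \<beta> D e f) \<le> 1 * real N"
    using abs_moebius_mu_le_1[of e] fit_count_le[of N \<beta> D e f] by (intro mult_mono) auto
  then show ?thesis using assms by (simp add: convolution_weight_def norm_mult norm_divide)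
qed

lemma sum_convolution_weight:
  assumes "n > 0" "N > 0"
  shows "(\<Sum>(D, e) | D * e dvd n. convolution_weight N \<beta> D e (n div (D * e)) * of_nat (n div (D * e)))
    = of_nat (card {x. x < n \<and> fits N \<beta> (gcd x n) (n div gcd x n) (x div gcd x n)})"
proof -
  have "convolution_weight N \<beta> D e f * of_nat f
      = of_int (moebius_mu e * int (card {i. i < f \<and> fits N \<beta> D (e * f) (e * i)}))" for D e f
  proof -
    have "of_nat f * of_nat (fit_count N \<beta> D e f)
        = (of_nat N * of_nat (card {i. i < f \<and> fits N \<beta> D (e * f) (e * i)}) :: complex)"
      using card_fits[of N f \<beta> D e] by (metis of_nat_mult)
    then show ?thesis using assms(2) by (simp add: convolution_weight_def field_simps)
  qed
  then have "(\<Sum>(D, e) | D * e dvd n. convolution_weight N \<beta> D e (n div (D * e)) * of_nat (n div (D * e)))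
      = of_int (\<Sum>(D, e) | D * e dvd n. moebius_mu e
          * int (card {i. i < n div (D * e) \<and> fits N \<beta> D (e * (n div (D * e))) (e * i)}))"
    by (simp add: case_prod_unfold del: of_int_mult)
  then show ?thesis unfolding card_fits_gcd[OF assms(1), symmetric] by simp
qed

text \<open>The convolution is indexed by the modulus \<open>n = m N\<close> instead of \<open>m\<close>; passing from one to the other
  produces the entire factor \<open>N\<^sup>s\<close>.\<close>

lemma dirichlet_series_admissible_residues:
  assumes "N > 0"
  obtains W where "W holomorphic_on {s. Re s > 1}"
    "\<And>s. Re s > 2 \<Longrightarrow>
       dirichlet_series (\<lambda>m. of_nat (card (admissible_residues (int N) \<beta> m))) s = W s / (s - 2)"
proof -
  define V where "V = (\<lambda>s. \<Sum>j=1..N. (\<Sum>\<^sub>\<infinity>(D, e)\<in>{1..} \<times> {1..}.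
      convolution_weight N \<beta> D e j * of_real (real (D * e)) powr (- s)) * progression_zeta_numerator N j (s - 1))"
  have "V holomorphic_on {s. Re s > 1}"
    unfolding V_def using assms norm_convolution_weight_le_1[OF assms]
    by (rule holomorphic_dirichlet_convolution)
  then have hol: "(\<lambda>s. of_nat N powr s * V s) holomorphic_on {s. Re s > 1}"
    using assms by (auto intro!: holomorphic_intros)
  define A where "A = (\<lambda>n. card {x. x < n \<and> fits N \<beta> (gcd x n) (n div gcd x n) (x div gcd x n)})"
  have "dirichlet_series (\<lambda>m. of_nat (card (admissible_residues (int N) \<beta> m))) s
      = (of_nat N powr s * V s) / (s - 2)" if s: "Re s > 2" for s
  proof -
    have per: "convolution_weight N \<beta> D e (f + N) = convolution_weight N \<beta> D e f" for D e f
      using fit_count_cong[of "f + N" f N \<beta> D e] by (simp add: convolution_weight_def unique_euclidean_semiring_class.cong_def)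
    have conv: "((\<lambda>n. (\<Sum>(D, e) | D * e dvd n.
          convolution_weight N \<beta> D e (n div (D * e)) * of_nat (n div (D * e))) * of_nat n powr (- s))
        has_sum (V s / (s - 2))) {1..}"
      unfolding V_def
      by (rule has_sum_dirichlet_convolution[where h = "convolution_weight N \<beta>",
            OF assms norm_convolution_weight_le_1[OF assms] per s])
    have "((\<lambda>n. of_nat (A n) * of_nat n powr (- s)) has_sum (V s / (s - 2))) {1..}"
    proof (rule has_sum_cong[THEN iffD1, OF _ conv])
      fix n :: nat assume "n \<in> {1..}"
      then have "n > 0" by simp
      show "(\<Sum>(D, e) | D * e dvd n. convolution_weight N \<beta> D e (n div (D * e)) * of_nat (n div (D * e)))
          * of_nat n powr (- s) = of_nat (A n) * of_nat n powr (- s)"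
        unfolding A_def sum_convolution_weight[OF \<open>n > 0\<close> assms] ..
    qed
    also have "?this \<longleftrightarrow> ((\<lambda>n. of_nat (A n) * of_nat n powr (- s)) has_sum (V s / (s - 2)))
        (range (\<lambda>k. Suc k * N))"
    proof (rule has_sum_cong_neutral)
      fix n assume n: "n \<in> {1..} - range (\<lambda>k. Suc k * N)"
      have "\<not> N dvd n"
      proof
        assume "N dvd n"
        then obtain q where "n = q * N" by (metis dvdE mult.commute)
        then show False using n by (cases q) auto
      qed
      then show "of_nat (A n) * of_nat n powr (- s) = (0 :: complex)"
        using not_fits_gcd by (simp add: A_def)
    qed (use assms in auto)
    also have "\<dots> \<longleftrightarrow> ((\<lambda>k. of_nat (A (Suc k * N)) * of_nat (Suc k * N) powr (- s))
        has_sum (V s / (s - 2))) UNIV"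
      by (subst has_sum_reindex) (use assms in \<open>auto simp: inj_on_def o_def\<close>)
    finally have "(\<lambda>k. of_nat N powr s * (of_nat (A (Suc k * N)) * of_nat (Suc k * N) powr (- s)))
        sums (of_nat N powr s * (V s / (s - 2)))"
      by (intro sums_mult has_sum_imp_sums)
    moreover have "of_nat N powr s * (of_nat (A (Suc k * N)) * of_nat (Suc k * N) powr (- s))
        = dirichlet_term (\<lambda>m. of_nat (card (admissible_residues (int N) \<beta> m))) s k" for k
    proof -
      have "of_nat N powr s * of_nat N powr (- s) = (1 :: complex)"
        using assms by (simp add: powr_minus)
      then show ?thesis
        unfolding dirichlet_term_def card_admissible_residues[OF zero_less_Suc assms] A_def
          of_nat_mult_powr by (simp add: mult_ac)
    qed
    ultimately show ?thesis unfolding dirichlet_series_def by (simp add: sums_iff)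
  qed
  then show ?thesis using that hol by blast
qed

lemma dirichlet_term_cong:
  assumes "\<And>m. m > 0 \<Longrightarrow> a m = b m"
  shows "dirichlet_term a = dirichlet_term b"
  using assms by (auto simp: fun_eq_iff dirichlet_term_def)

theorem corollary1p2:
  fixes L :: "(rat ^ 2) set"
  assumes "sublattice L hyperbolic_plane"
  shows "abscissa_of_convergence (zeta_SL_coeff L) = 2 \<and>
    (\<exists>F. F meromorphic_on {s. Re s > 1} \<and>
         (\<forall>s. Re s > 2 \<longrightarrow> F s = zeta_SL L s) \<and>
         is_pole F 2 \<and> zorder F 2 = - 1)"
proof -
  obtain N \<beta> c where N: "N > 0" "c > 0" and L: "L = stretch (1 / of_int c) ` normal_lattice N \<beta>"
    by (rule sublattice_hyperbolic_plane_normal[OF assms])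
  define a where "a = (\<lambda>m. card (admissible_residues N \<beta> m))"
  obtain W where hol: "W holomorphic_on {s. Re s > 1}"
    and W: "\<And>s. Re s > 2 \<Longrightarrow> dirichlet_series (\<lambda>m. of_nat (a m)) s = W s / (s - 2)"
  proof (rule dirichlet_series_admissible_residues[of "nat N" \<beta>])
    show "nat N > 0" using N(1) by simp
  qed (use N(1) in \<open>simp add: a_def\<close>)
  have "m \<le> a m" "a m \<le> nat N * m" if "m > 0" for m
    using card_admissible_residues_bounds that N(1) by (auto simp: a_def)
  note pole = simple_pole_of_linear_growth[OF this hol W]
  have term_eq: "dirichlet_term (zeta_SL_coeff L) = dirichlet_term (\<lambda>m. of_nat (a m))"
    by (rule dirichlet_term_cong)
      (simp add: zeta_SL_coeff_def a_def num_proper_classes_eq[OF N _ L])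
  have "abscissa_of_convergence (zeta_SL_coeff L) = 2"
    using pole(1) by (simp add: abscissa_of_convergence_def term_eq)
  moreover have "W s / (s - 2) = zeta_SL L s" if "Re s > 2" for s
    using W[OF that] by (simp add: zeta_SL_def dirichlet_series_def term_eq)
  ultimately show ?thesis using pole(2-4) by blast
qed

end
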